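(* Let $V_1,\ldots,V_r \subset \mathbb{C}^d$ be linear subspaces. Then the algebraic sum $\mathcal{F}(V_1) + \ldots + \mathcal{F}(V_r) \subset \mathcal{F}(\mathbb{C}^d)$ is closed.
   Context: For a finite dimensional Hilbert space $E$, $\mathcal{F}(E) = \bigoplus_{n=0}^\infty E^{\otimes n}$ (Hilbert space direct sum, $E^{\otimes 0} = \mathbb{C}$) denotes the full Fock space over $E$. If $V \subset E$ is a subspace, $\mathcal{F}(V)$ is regarded as a closed subspace of $\mathcal{F}(E)$. $\mathbb{C}^d$ carries its standard inner product. *)

theory Defs
  imports "HOL-Analysis.Analysis" "HOL-Library.Set_Algebras"
begin

text \<open>
  We write a tensor in the \<open>n\<close>-th tensor power of \<open>\<complex>\<^sup>d\<close> in the orthonormal basis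
  \<open>e\<^sub>i\<^sub>1 \<otimes> \<dots> \<otimes> e\<^sub>i\<^sub>n\<close>, that is, as a family of complex coefficients indexed by the words
  \<open>[i\<^sub>1, \<dots>, i\<^sub>n]\<close> of length \<open>n\<close> over the index type \<open>'d\<close>; the empty word spans the zeroth power
  \<open>\<complex>\<close>.  The Hilbert space direct sum of all tensor powers thus consists of the
  square-summable families indexed by words of arbitrary length.
\<close>

typedef 'd fock = "{f :: 'd list \<Rightarrow> complex. (\<lambda>w. (cmod (f w))\<^sup>2) summable_on UNIV}"
  morphisms coeff Abs_fock
  by (rule exI[of _ "\<lambda>_. 0"]) simp

setup_lifting type_definition_fock

lemma fock_eqI: "(\<And>w. coeff f w = coeff g w) \<Longrightarrow> f = g"
  by (metis coeff_inject ext)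

lemma sq_summable_coeff: "(\<lambda>w. (cmod (coeff f w))\<^sup>2) summable_on UNIV"
  using coeff[of f] by simp

lemma sq_summable_add:
  fixes f g :: "'a \<Rightarrow> complex"
  assumes "(\<lambda>w. (cmod (f w))\<^sup>2) summable_on A" "(\<lambda>w. (cmod (g w))\<^sup>2) summable_on A"
  shows "(\<lambda>w. (cmod (f w + g w))\<^sup>2) summable_on A"
proof (rule summable_on_comparison_test)
  show "(\<lambda>w. 2 * (cmod (f w))\<^sup>2 + 2 * (cmod (g w))\<^sup>2) summable_on A"
    by (intro summable_on_add summable_on_cmult_right assms)
  fix w
  have "(cmod (f w + g w))\<^sup>2 \<le> (cmod (f w) + cmod (g w))\<^sup>2"
    by (intro power_mono norm_triangle_ineq) auto
  also have "\<dots> \<le> 2 * (cmod (f w))\<^sup>2 + 2 * (cmod (g w))\<^sup>2"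
    using sum_squares_bound[of "cmod (f w)" "cmod (g w)"] by (simp add: power2_sum)
  finally show "(cmod (f w + g w))\<^sup>2 \<le> 2 * (cmod (f w))\<^sup>2 + 2 * (cmod (g w))\<^sup>2" .
qed auto

lemma sq_summable_scale:
  fixes f :: "'a \<Rightarrow> complex"
  assumes "(\<lambda>w. (cmod (f w))\<^sup>2) summable_on A"
  shows "(\<lambda>w. (cmod (c * f w))\<^sup>2) summable_on A"
  using summable_on_cmult_right[OF assms, of "(cmod c)\<^sup>2"]
  by (simp add: norm_mult power_mult_distrib)

lemma summable_inner_coeff: "(\<lambda>w. coeff f w \<bullet> coeff g w) summable_on UNIV"
proof (rule Infinite_Sum.abs_summable_summable, rule Infinite_Sum.abs_summable_on_comparison_test')
  show "(\<lambda>w. (cmod (coeff f w))\<^sup>2 + (cmod (coeff g w))\<^sup>2) summable_on UNIV"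
    by (intro summable_on_add sq_summable_coeff)
  fix w
  have "norm (coeff f w \<bullet> coeff g w) \<le> cmod (coeff f w) * cmod (coeff g w)"
    using Cauchy_Schwarz_ineq2 by simp
  also have "\<dots> \<le> (cmod (coeff f w))\<^sup>2 + (cmod (coeff g w))\<^sup>2"
    using sum_squares_bound[of "cmod (coeff f w)" "cmod (coeff g w)"]
      mult_nonneg_nonneg[OF norm_ge_zero[of "coeff f w"] norm_ge_zero[of "coeff g w"]]
    by linarith
  finally show "norm (coeff f w \<bullet> coeff g w) \<le> (cmod (coeff f w))\<^sup>2 + (cmod (coeff g w))\<^sup>2" .
qed

instantiation fock :: (type) real_vector
begin

lift_definition zero_fock :: "'a fock" is "\<lambda>_. 0" by simp

lift_definition plus_fock :: "'a fock \<Rightarrow> 'a fock \<Rightarrow> 'a fock" is "\<lambda>f g w. f w + g w"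
  by (rule sq_summable_add)

lift_definition uminus_fock :: "'a fock \<Rightarrow> 'a fock" is "\<lambda>f w. - f w" by simp

lift_definition minus_fock :: "'a fock \<Rightarrow> 'a fock \<Rightarrow> 'a fock" is "\<lambda>f g w. f w - g w"
  using sq_summable_add[where g = "\<lambda>w. - g w" for g] by simp

lift_definition scaleR_fock :: "real \<Rightarrow> 'a fock \<Rightarrow> 'a fock" is "\<lambda>r f w. r *\<^sub>R f w"
  using sq_summable_scale[where c = "of_real r" for r] by (simp add: scaleR_conv_of_real)

instance
  by standard (transfer; auto simp: algebra_simps)+

end

lift_definition scaleC :: "complex \<Rightarrow> 'd fock \<Rightarrow> 'd fock" is "\<lambda>c f w. c * f w"
  by (rule sq_summable_scale)

global_interpretation cfock: vector_space "scaleC :: complex \<Rightarrow> 'd fock \<Rightarrow> 'd fock"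
  by standard (transfer; auto simp: algebra_simps)+

text \<open>
  The class \<^class>\<open>real_inner\<close> supplies the norm and the topology.  Its inner product is the real
  part of the complex inner product \<open>\<Sum>\<^sub>w f w * cnj (g w)\<close>, which has the same norm; see
  \<open>norm_fock\<close> below.
\<close>

instantiation fock :: (type) real_inner
begin

definition inner_fock :: "'a fock \<Rightarrow> 'a fock \<Rightarrow> real"
  where "inner_fock f g = (\<Sum>\<^sub>\<infinity>w. coeff f w \<bullet> coeff g w)"

definition norm_fock_inner: "norm (f :: 'a fock) = sqrt (f \<bullet> f)"

definition sgn_fock :: "'a fock \<Rightarrow> 'a fock"
  where "sgn_fock f = inverse (norm f) *\<^sub>R f"

definition dist_fock :: "'a fock \<Rightarrow> 'a fock \<Rightarrow> real"
  where "dist_fock f g = norm (f - g)"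

definition uniformity_fock :: "('a fock \<times> 'a fock) filter"
  where "uniformity_fock = (INF e\<in>{0<..}. principal {(f, g). dist f g < e})"

definition open_fock :: "'a fock set \<Rightarrow> bool"
  where "open_fock U \<longleftrightarrow> (\<forall>f\<in>U. eventually (\<lambda>(f', g). f' = f \<longrightarrow> g \<in> U) uniformity)"

instance
proof
  fix f g h :: "'a fock" and r :: real
  show "f \<bullet> g = g \<bullet> f"
    by (simp add: inner_fock_def inner_commute)
  show "(f + g) \<bullet> h = f \<bullet> h + g \<bullet> h"
    by (simp add: inner_fock_def plus_fock.rep_eq inner_add_left infsum_add summable_inner_coeff)
  show "(r *\<^sub>R f) \<bullet> g = r * (f \<bullet> g)"
    by (simp add: inner_fock_def scaleR_fock.rep_eq infsum_cmult_right')
  show "0 \<le> f \<bullet> f"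
    by (simp add: inner_fock_def infsum_nonneg)
  show "f \<bullet> f = 0 \<longleftrightarrow> f = 0"
  proof
    assume "f \<bullet> f = 0"
    then have "coeff f w \<bullet> coeff f w = 0" for w
      using nonneg_infsum_le_0D[OF _ summable_inner_coeff[of f f]] by (simp add: inner_fock_def)
    then show "f = 0"
      by (intro fock_eqI) (simp add: zero_fock.rep_eq)
  qed (simp add: inner_fock_def zero_fock.rep_eq)
qed (simp_all add: norm_fock_inner sgn_fock_def dist_fock_def uniformity_fock_def open_fock_def)

end

lemma norm_fock: "norm f = sqrt (\<Sum>\<^sub>\<infinity>w. (cmod (coeff f w))\<^sup>2)"
  by (simp add: norm_fock_inner inner_fock_def dot_square_norm)

text \<open>The elementary tensor \<open>v\<^sub>1 \<otimes> \<dots> \<otimes> v\<^sub>n\<close>, with \<open>tensor []\<close> the vacuum vector \<open>1 \<in> \<complex>\<close>.\<close>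

lift_definition tensor :: "(complex ^ 'd) list \<Rightarrow> 'd fock" is
  "\<lambda>vs w. if length w = length vs then \<Prod>i<length vs. vs ! i $ (w ! i) else 0"
proof -
  fix vs :: "(complex ^ 'd) list"
  have "finite {w :: 'd list. length w = length vs}"
    using finite_lists_length_eq[of "UNIV :: 'd set" "length vs"] by simp
  then show "(\<lambda>w. (cmod (if length w = length vs then \<Prod>i<length vs. vs ! i $ (w ! i) else 0))\<^sup>2)
      summable_on UNIV"
    by (intro finite_nonzero_values_imp_summable_on) (auto elim: rev_finite_subset)
qed

definition tensor_power :: "nat \<Rightarrow> (complex ^ 'd) set \<Rightarrow> 'd fock set"
  where "tensor_power n V = cfock.span {tensor vs | vs. length vs = n \<and> set vs \<subseteq> V}"

lift_definition component :: "nat \<Rightarrow> 'd fock \<Rightarrow> 'd fock" is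
  "\<lambda>n f w. if length w = n then f w else 0"
  by (erule summable_on_comparison_test) auto

text \<open>\<open>\<F>(V)\<close> as a subspace of \<open>\<F>(\<complex>\<^sup>d)\<close>: the Hilbert space direct sum of the tensor powers of \<open>V\<close>.\<close>

definition Fock :: "(complex ^ 'd) set \<Rightarrow> 'd fock set"
  where "Fock V = {f. \<forall>n. component n f \<in> tensor_power n V}"

text \<open>
  Two consistency checks: the Fock space of the whole of \<open>\<complex>\<^sup>d\<close> is the whole type, and the
  inner product is multiplicative on elementary tensors.
\<close>

lemma coeff_sum: "coeff (\<Sum>x\<in>A. f x) w = (\<Sum>x\<in>A. coeff (f x) w)"
  by (induction A rule: infinite_finite_induct) (simp_all add: zero_fock.rep_eq plus_fock.rep_eq)

lemma Fock_UNIV: "Fock (UNIV :: (complex ^ 'd) set) = UNIV"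
proof -
  have "component n f \<in> tensor_power n (UNIV :: (complex ^ 'd) set)" for n and f :: "'d fock"
  proof -
    let ?W = "{w :: 'd list. length w = n}"
    let ?e = "\<lambda>w :: 'd list. tensor (map (\<lambda>j. axis j 1) w)"
    have fin: "finite ?W"
      using finite_lists_length_eq[of "UNIV :: 'd set" n] by simp
    have e: "coeff (?e w) u = (if u = w then 1 else 0)" for u w
    proof (cases "length u = length w")
      case True
      show ?thesis
      proof (cases "u = w")
        case False
        then obtain i where "i < length w" "u ! i \<noteq> w ! i"
          using True nth_equalityI by metis
        then show ?thesis using True False
          by (auto simp: tensor.rep_eq axis_def intro!: prod_zero bexI[of _ i])
      qed (simp add: tensor.rep_eq axis_def)
    next
      case False
      then have "u \<noteq> w" by auto
      with False show ?thesis by (simp add: tensor.rep_eq)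
    qed
    have "component n f = (\<Sum>w\<in>?W. scaleC (coeff f w) (?e w))"
    proof (rule fock_eqI)
      fix u
      have "coeff (\<Sum>w\<in>?W. scaleC (coeff f w) (?e w)) u = (\<Sum>w\<in>?W. if w = u then coeff f w else 0)"
        unfolding coeff_sum by (intro sum.cong) (auto simp: scaleC.rep_eq e)
      then show "coeff (component n f) u = coeff (\<Sum>w\<in>?W. scaleC (coeff f w) (?e w)) u"
        using fin by (simp add: component.rep_eq)
    qed
    also have "\<dots> \<in> tensor_power n UNIV"
      unfolding tensor_power_def
      by (intro cfock.span_sum cfock.span_scale cfock.span_base) auto
    finally show ?thesis .
  qed
  then show ?thesis by (auto simp: Fock_def)
qed

definition cinner :: "'d fock \<Rightarrow> 'd fock \<Rightarrow> complex"
  where "cinner f g = (\<Sum>\<^sub>\<infinity>w. coeff f w * cnj (coeff g w))"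

lemma sum_lists_prod:
  fixes f :: "nat \<Rightarrow> 'd::finite \<Rightarrow> complex"
  shows "(\<Sum>w | length w = n. \<Prod>i<n. f i (w ! i)) = (\<Prod>i<n. \<Sum>j\<in>UNIV. f i j)"
proof (induction n arbitrary: f)
  case (Suc n)
  have "bij_betw (\<lambda>(j, w). j # w) (UNIV \<times> {w. length w = n}) {w :: 'd list. length w = Suc n}"
    by (rule bij_betwI[of _ _ _ "\<lambda>w. (hd w, tl w)"]) (auto simp: length_Suc_conv)
  from sum.reindex_bij_betw[OF this, of "\<lambda>w. \<Prod>i<Suc n. f i (w ! i)"]
  have "(\<Sum>w | length w = Suc n. \<Prod>i<Suc n. f i (w ! i)) =
      (\<Sum>(j, w)\<in>UNIV \<times> {w. length w = n}. f 0 j * (\<Prod>i<n. f (Suc i) (w ! i)))"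
    by (simp add: case_prod_beta prod.lessThan_Suc_shift del: prod.lessThan_Suc)
  also have "\<dots> = (\<Sum>j\<in>UNIV. f 0 j) * (\<Sum>w | length w = n. \<Prod>i<n. f (Suc i) (w ! i))"
    by (simp add: sum_product sum.cartesian_product)
  also have "\<dots> = (\<Prod>i<Suc n. \<Sum>j\<in>UNIV. f i j)"
    by (simp add: Suc.IH[of "\<lambda>i. f (Suc i)"] prod.lessThan_Suc_shift del: prod.lessThan_Suc)
  finally show ?case .
qed simp

lemma cinner_tensor:
  fixes vs ws :: "(complex ^ 'd) list"
  shows "cinner (tensor vs) (tensor ws) =
    (if length vs = length ws
     then \<Prod>i<length vs. \<Sum>j\<in>UNIV. vs ! i $ j * cnj (ws ! i $ j) else 0)"
proof (cases "length vs = length ws")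
  case True
  have fin: "finite {w :: 'd list. length w = length vs}"
    using finite_lists_length_eq[of "UNIV :: 'd set" "length vs"] by simp
  have "cinner (tensor vs) (tensor ws) =
      (\<Sum>\<^sub>\<infinity>w\<in>{w. length w = length vs}. \<Prod>i<length vs. vs ! i $ (w ! i) * cnj (ws ! i $ (w ! i)))"
    unfolding cinner_def using True
    by (intro infsum_cong_neutral) (auto simp: tensor.rep_eq prod.distrib cnj_prod)
  also have "\<dots> = (\<Prod>i<length vs. \<Sum>j\<in>UNIV. vs ! i $ j * cnj (ws ! i $ j))"
    using fin by (simp add: sum_lists_prod[of "\<lambda>i j. vs ! i $ j * cnj (ws ! i $ j)"])
  finally show ?thesis using True by simp
next
  case False
  then show ?thesis by (simp add: cinner_def tensor.rep_eq infsum_0)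
qed

end

(* The sum is closed once relations are uniformly stable in the level n: every tuple (x_i) with
   x_i in the n-th tensor power of V_i lies within C * norm (sum x_i) of an exact relation
   (sum zero), with C independent of n. This is shown by induction on the number r of subspaces.
   Splitting off W = V_1 \<inter> ... \<inter> V_r position by position reduces to W = 0. Then a product of the
   orthogonal projections P_i that involves all of them is a strict contraction, so its n-th
   tensor power tends to 0. With T x = sum x_i, powers of 1 - T*T/r almost fix a tuple x with
   T x small, while the same powers without the index j send x almost to an exact relation, by
   induction. So subtracting an exact relation moves x almost to M_j x, where every entry of M_j
   is a combination of words containing P_j. Doing this for all j in turn leaves M_1 ... M_r x,
   whose words contain all letters, so it is small for large n; the finitely many remaining n
   are finite-dimensional. *)

theory Submission
  imports Defs
begin

section \<open>Tuples in a finite family of subspaces\<close>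

text \<open>The uniform constant yields closedness because it lets the summands be chosen level by
  level with norms at most C times that of the given component, so that they are square summable
  again. Hence membership in the algebraic sum becomes a condition on each level separately, and
  there it is closed by finite dimension. For two subspaces with W = 0 the product of the two
  projections is itself small at high levels. The obstacle begins with three: a proper subfamily may
  still have a nonzero intersection, so words that omit a letter need not decay and pairwise
  estimates are not enough. Every word has to be forced to contain all letters, and the subfamilies
  are controlled by the induction instead. W can be split off without any loss in C because its
  projection is the same for all i: applied in one position, it maps relations to relations and
  splits the tuples and their sums orthogonally. The exponent of the powers depends only on r and on
  the constants of the subfamilies. So M_1 ... M_r is one fixed combination of words, and n is taken
  large only afterwards.\<close>

definition tuple_norm :: "'i set \<Rightarrow> ('i \<Rightarrow> 'a::real_inner) \<Rightarrow> real"
  where "tuple_norm I x = L2_set (\<lambda>i. norm (x i)) I"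

text \<open>With \<open>T x = (\<Sum>i\<in>I. x i)\<close>, this says that \<open>x\<close> has an
  element of the kernel of \<open>T\<close> within \<open>C * norm (T x)\<close>: a quantitative
  form of closed range. Asking for an explicit relation \<open>y\<close> instead of a distance lets
  relations be added, rotated and glued.\<close>

definition stable_sum :: "'i set \<Rightarrow> ('i \<Rightarrow> 'a::real_inner set) \<Rightarrow> real \<Rightarrow> bool"
  where "stable_sum I H C \<longleftrightarrow> (\<forall>x. (\<forall>i\<in>I. x i \<in> H i) \<longrightarrow>
    (\<exists>y. (\<forall>i\<in>I. y i \<in> H i) \<and> (\<Sum>i\<in>I. y i) = 0 \<and>
      tuple_norm I (\<lambda>i. x i - y i) \<le> C * norm (\<Sum>i\<in>I. x i)))"

lemma tuple_norm_nonneg [simp]: "0 \<le> tuple_norm I x"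
  by (simp add: tuple_norm_def L2_set_nonneg)

text \<open>Additivity of the squares is what lets orthogonal splittings and slices of tensors keep
  the constant of \<open>stable_sum\<close> unchanged.\<close>

lemma tuple_norm_square: "(tuple_norm I x)\<^sup>2 = (\<Sum>i\<in>I. (norm (x i))\<^sup>2)"
  by (simp add: tuple_norm_def L2_set_def sum_nonneg)

lemma tuple_norm_cong: "(\<And>i. i \<in> I \<Longrightarrow> x i = y i) \<Longrightarrow> tuple_norm I x = tuple_norm I y"
  by (simp add: tuple_norm_def cong: L2_set_cong)

lemma tuple_norm_0 [simp]: "tuple_norm I (\<lambda>i. 0) = 0"
  by (simp add: tuple_norm_def L2_set_def)

lemma tuple_norm_add: "tuple_norm I (\<lambda>i. x i + y i) \<le> tuple_norm I x + tuple_norm I y"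
proof -
  have "tuple_norm I (\<lambda>i. x i + y i) \<le> L2_set (\<lambda>i. norm (x i) + norm (y i)) I"
    unfolding tuple_norm_def by (intro L2_set_mono norm_triangle_ineq) auto
  also have "\<dots> \<le> tuple_norm I x + tuple_norm I y"
    unfolding tuple_norm_def by (rule L2_set_triangle_ineq)
  finally show ?thesis .
qed

lemma tuple_norm_minus: "tuple_norm I (\<lambda>i. x i - y i) = tuple_norm I (\<lambda>i. y i - x i)"
  by (simp add: tuple_norm_def norm_minus_commute)

lemma tuple_norm_diff: "tuple_norm I (\<lambda>i. x i - y i) \<le> tuple_norm I x + tuple_norm I y"
  using tuple_norm_add[of I x "\<lambda>i. - y i"] by (simp add: tuple_norm_def)

lemma tuple_norm_triangle:
  "tuple_norm I (\<lambda>i. x i - z i) \<le> tuple_norm I (\<lambda>i. x i - y i) + tuple_norm I (\<lambda>i. y i - z i)"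
  using tuple_norm_add[of I "\<lambda>i. x i - y i" "\<lambda>i. y i - z i"] by simp

lemma tuple_norm_le:
  "tuple_norm I x \<le> tuple_norm I (\<lambda>i. x i - y i) + tuple_norm I y"
  using tuple_norm_triangle[of I x "\<lambda>_. 0" y] by simp

lemma tuple_norm_scaleR: "tuple_norm I (\<lambda>i. c *\<^sub>R x i) = \<bar>c\<bar> * tuple_norm I x"
  by (simp add: tuple_norm_def L2_set_right_distrib)

lemma tuple_norm_subset: "finite I \<Longrightarrow> F \<subseteq> I \<Longrightarrow> tuple_norm F x \<le> tuple_norm I x"
  unfolding tuple_norm_def L2_set_def by (intro real_sqrt_le_mono sum_mono2) auto

lemma norm_le_tuple_norm: "finite I \<Longrightarrow> i \<in> I \<Longrightarrow> norm (x i) \<le> tuple_norm I x"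
  unfolding tuple_norm_def by (rule member_le_L2_set)

lemma tuple_norm_le_iff: "0 \<le> c \<Longrightarrow> tuple_norm I x \<le> c \<longleftrightarrow> (\<Sum>i\<in>I. (norm (x i))\<^sup>2) \<le> c\<^sup>2"
  by (simp add: tuple_norm_square[symmetric] abs_le_square_iff[symmetric])

lemma tuple_norm_single:
  "finite I \<Longrightarrow> a \<in> I \<Longrightarrow> tuple_norm I (\<lambda>i. if i = a then v else 0) = norm v"
  by (simp add: tuple_norm_def L2_set_def if_distrib[of norm] if_distrib[of "\<lambda>x. x\<^sup>2"] sum.delta cong: if_cong)

lemma stable_sum_mono:
  assumes "stable_sum I H C" "C \<le> C'" shows "stable_sum I H C'"
  unfolding stable_sum_def
proof (intro allI impI)
  fix x assume "\<forall>i\<in>I. x i \<in> H i"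
  with assms(1) obtain y where "\<forall>i\<in>I. y i \<in> H i" "(\<Sum>i\<in>I. y i) = 0"
      "tuple_norm I (\<lambda>i. x i - y i) \<le> C * norm (\<Sum>i\<in>I. x i)"
    unfolding stable_sum_def by blast
  moreover have "C * norm (\<Sum>i\<in>I. x i) \<le> C' * norm (\<Sum>i\<in>I. x i)"
    using assms(2) by (rule mult_right_mono) simp
  ultimately show "\<exists>y. (\<forall>i\<in>I. y i \<in> H i) \<and> (\<Sum>i\<in>I. y i) = 0 \<and>
      tuple_norm I (\<lambda>i. x i - y i) \<le> C' * norm (\<Sum>i\<in>I. x i)"
    by (metis order.trans)
qed

text \<open>The vectors of \<open>B\<close> are not normalised and may include 0, whose term
  vanishes whatever its coefficient is.\<close>

lemma orthogonal_expansion: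
  fixes B :: "'a::real_inner set"
  assumes "finite B" "pairwise orthogonal B" "v \<in> span B"
  shows "(\<Sum>b\<in>B. (v \<bullet> b / (b \<bullet> b)) *\<^sub>R b) = v"
  using assms(3)
proof (induction rule: span_induct_alt)
  case (step c x y)
  have "(\<Sum>b\<in>B. (x \<bullet> b / (b \<bullet> b)) *\<^sub>R b) = (\<Sum>b\<in>B. if b = x then x else 0)"
    using step(1) assms(2)
    by (intro sum.cong) (auto simp: pairwise_def orthogonal_def)
  also have "\<dots> = x" using step(1) assms(1) by simp
  finally show ?case using step(2)
    by (simp add: inner_add_left add_divide_distrib scaleR_add_left sum.distrib
        flip: scaleR_sum_right scaleR_scaleR times_divide_eq_right)
qed simp

lemma finite_dim_orthogonal_basis:
  fixes S :: "'a::real_inner set"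
  assumes "subspace S" "finite B" "S \<subseteq> span B"
  obtains C where "finite C" "pairwise orthogonal C" "span C = S"
proof -
  obtain A where A: "A \<subseteq> S" "independent A" "S \<subseteq> span A"
    using maximal_independent_subset[of S] by metis
  have "finite A"
    using independent_span_bound[OF assms(2) A(2)] A(1) assms(3) by blast
  moreover have "span A = S" using A assms(1) by (simp add: span_subspace)
  ultimately show ?thesis using basis_orthogonal[of A] that by metis
qed

text \<open>The subspace is the set where the continuous expansion map in an orthogonal basis agrees
  with the identity. The ambient space may be infinite-dimensional.\<close>

lemma closed_finite_dim_subspace:
  fixes S :: "'a::real_inner set"
  assumes "subspace S" "finite B" "S \<subseteq> span B"
  shows "closed S"
proof -
  obtain C where C: "finite C" "pairwise orthogonal C" "span C = S"
    using finite_dim_orthogonal_basis[OF assms] .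
  have "S = {v. (\<Sum>b\<in>C. (v \<bullet> b / (b \<bullet> b)) *\<^sub>R b) = v}"
  proof (intro equalityI subsetI; clarify?)
    fix v assume "(\<Sum>b\<in>C. (v \<bullet> b / (b \<bullet> b)) *\<^sub>R b) = v"
    moreover have "(\<Sum>b\<in>C. (v \<bullet> b / (b \<bullet> b)) *\<^sub>R b) \<in> span C"
      by (intro span_sum span_scale span_base)
    ultimately show "v \<in> S" using C by simp
  qed (use orthogonal_expansion C in auto)
  also have "closed \<dots>"
    unfolding divide_inverse by (intro closed_Collect_eq continuous_intros)
  finally show ?thesis .
qed

lemma subspace_sum_choice:
  fixes H :: "'i \<Rightarrow> 'a::real_vector set"
  assumes "\<And>i. i \<in> I \<Longrightarrow> subspace (H i)"
  shows "subspace {(\<Sum>i\<in>I. x i) |x. \<forall>i\<in>I. x i \<in> H i}"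
  unfolding subspace_def
proof (safe, goal_cases)
  case 1
  then show ?case using assms by (auto intro!: exI[of _ "\<lambda>_. 0"] simp: subspace_0)
next
  case (2 _ _ x y)
  then show ?case using assms
    by (auto intro!: exI[of _ "\<lambda>i. x i + y i"] simp: subspace_add sum.distrib)
next
  case (3 c _ x)
  then show ?case using assms
    by (auto intro!: exI[of _ "\<lambda>i. c *\<^sub>R x i"] simp: subspace_scale scaleR_sum_right)
qed

text \<open>Fixing a preimage tuple \<open>s e\<close> for each vector \<open>e\<close> of an
  orthogonal basis of the image gives a bounded linear section of the summation map. Subtracting the
  section's value from \<open>x\<close> leaves a relation.\<close>

lemma finite_dim_stable_sum:
  fixes H :: "'i \<Rightarrow> 'a::real_inner set"
  assumes I: "finite I" and H: "\<And>i. i \<in> I \<Longrightarrow> subspace (H i)"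
    and B: "finite B" "\<And>i. i \<in> I \<Longrightarrow> H i \<subseteq> span B"
  shows "\<exists>C. stable_sum I H C"
proof -
  define S where "S = {(\<Sum>i\<in>I. x i) |x. \<forall>i\<in>I. x i \<in> H i}"
  have "subspace S" unfolding S_def by (rule subspace_sum_choice) (rule H)
  moreover have "S \<subseteq> span B" unfolding S_def using B(2) by (auto intro!: span_sum)
  ultimately obtain E where E: "finite E" "pairwise orthogonal E" "span E = S"
    using finite_dim_orthogonal_basis[OF _ B(1)] by metis
  have "\<exists>s. (\<forall>i\<in>I. s i \<in> H i) \<and> e = (\<Sum>i\<in>I. s i)" if "e \<in> E" for e
    using that span_base[of e E] unfolding E(3) S_def by blast
  then obtain s where s: "\<And>e i. e \<in> E \<Longrightarrow> i \<in> I \<Longrightarrow> s e i \<in> H i"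
      "\<And>e. e \<in> E \<Longrightarrow> e = (\<Sum>i\<in>I. s e i)"
    by metis
  \<comment> \<open>By Cauchy-Schwarz, the term for \<open>i\<close> and \<open>e\<close> bounds the
    rank one map that sends \<open>v\<close> to
    \<open>(v \<bullet> e / (e \<bullet> e)) *\<^sub>R s e i\<close>.\<close>
  define C where "C = (\<Sum>i\<in>I. \<Sum>e\<in>E. norm e / (e \<bullet> e) * norm (s e i))"
  have "stable_sum I H C"
    unfolding stable_sum_def
  proof (intro allI impI)
    fix x assume x: "\<forall>i\<in>I. x i \<in> H i"
    define v where "v = (\<Sum>i\<in>I. x i)"
    define u where "u i = (\<Sum>e\<in>E. (v \<bullet> e / (e \<bullet> e)) *\<^sub>R s e i)" for i
    have "v \<in> span E" unfolding E(3) S_def v_def using x by blast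
    have "(\<Sum>i\<in>I. u i) = (\<Sum>e\<in>E. (v \<bullet> e / (e \<bullet> e)) *\<^sub>R (\<Sum>i\<in>I. s e i))"
      unfolding u_def by (subst sum.swap) (simp add: scaleR_sum_right)
    also have "\<dots> = v"
      using orthogonal_expansion[OF E(1,2) \<open>v \<in> span E\<close>] s(2) by simp
    finally have u: "(\<Sum>i\<in>I. u i) = v" .
    have "norm (u i) \<le> (\<Sum>e\<in>E. norm e / (e \<bullet> e) * norm (s e i)) * norm v" for i
      unfolding u_def sum_distrib_right
    proof (rule sum_norm_le)
      fix e
      have "\<bar>v \<bullet> e\<bar> / (e \<bullet> e) * norm (s e i) \<le> (norm v * norm e) / (e \<bullet> e) * norm (s e i)"
        by (intro mult_right_mono divide_right_mono Cauchy_Schwarz_ineq2) auto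
      then show "norm ((v \<bullet> e / (e \<bullet> e)) *\<^sub>R s e i) \<le> norm e / (e \<bullet> e) * norm (s e i) * norm v"
        by (simp add: mult_ac)
    qed
    then have "(\<Sum>i\<in>I. norm (u i)) \<le> C * norm v"
      unfolding C_def sum_distrib_right by (intro sum_mono)
    moreover have "tuple_norm I u \<le> (\<Sum>i\<in>I. norm (u i))"
      unfolding tuple_norm_def by (rule L2_set_le_sum) auto
    ultimately have "tuple_norm I (\<lambda>i. x i - (x i - u i)) \<le> C * norm v" by simp
    moreover have "\<forall>i\<in>I. x i - u i \<in> H i"
      using x s(1) H unfolding u_def by (auto intro!: subspace_diff subspace_sum subspace_scale)
    moreover have "(\<Sum>i\<in>I. x i - u i) = 0"
      using u by (simp add: sum_subtractf v_def)
    ultimately show "\<exists>y. (\<forall>i\<in>I. y i \<in> H i) \<and> (\<Sum>i\<in>I. y i) = 0 \<and>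
        tuple_norm I (\<lambda>i. x i - y i) \<le> C * norm (\<Sum>i\<in>I. x i)"
      unfolding v_def by (intro exI[of _ "\<lambda>i. x i - u i"] conjI)
  qed
  then show ?thesis ..
qed

section \<open>Damped iteration towards relations\<close>

definition fixed_points :: "('a \<Rightarrow> 'a) \<Rightarrow> 'a set"
  where "fixed_points f = {v. f v = v}"

definition orth_proj :: "('a::real_inner \<Rightarrow> 'a) \<Rightarrow> bool"
  where "orth_proj f \<longleftrightarrow> linear f \<and> (\<forall>v w. f v \<bullet> w = v \<bullet> f w) \<and> (\<forall>v. f (f v) = f v)"

lemma orth_proj_linear: "orth_proj f \<Longrightarrow> linear f"
  and orth_proj_sym: "orth_proj f \<Longrightarrow> f v \<bullet> w = v \<bullet> f w"
  and orth_proj_idem: "orth_proj f \<Longrightarrow> f (f v) = f v"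
  by (auto simp: orth_proj_def)

lemma orth_proj_norm_le:
  assumes "orth_proj f" shows "norm (f v) \<le> norm v"
proof -
  have "(norm (f v))\<^sup>2 = v \<bullet> f v"
    using assms by (simp add: dot_square_norm[symmetric] orth_proj_sym orth_proj_idem)
  also have "\<dots> \<le> norm v * norm (f v)" by (rule norm_cauchy_schwarz)
  finally show ?thesis
    by (metis mult_le_cancel_right norm_ge_zero power2_eq_square norm_le_zero_iff not_less_iff_gr_or_eq order_less_le)
qed

locale projections =
  fixes I :: "'i set" and p :: "'i \<Rightarrow> 'a::real_inner \<Rightarrow> 'a"
  assumes finite_I: "finite I"
    and proj: "\<And>i. i \<in> I \<Longrightarrow> orth_proj (p i)"
begin

lemma p_linear: "i \<in> I \<Longrightarrow> linear (p i)"
  using proj orth_proj_linear by blast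

lemma p_simps [simp]:
  assumes "i \<in> I"
  shows "p i 0 = 0" "p i (v + w) = p i v + p i w" "p i (v - w) = p i v - p i w"
    "p i (c *\<^sub>R v) = c *\<^sub>R p i v" "p i (p i v) = p i v"
  using p_linear[OF assms] proj[OF assms]
  by (simp_all add: linear_0 linear_add linear_diff linear_scale orth_proj_idem)

definition fixed_tuple :: "('i \<Rightarrow> 'a) \<Rightarrow> bool"
  where "fixed_tuple x \<longleftrightarrow> (\<forall>i\<in>I. p i (x i) = x i)"

text \<open>With \<open>T x = (\<Sum>b\<in>F. x b)\<close>, this is \<open>1 - T\<^sup>* T / card I\<close> on tuples indexed by \<open>F\<close>;
  its powers converge to the projection onto the kernel of \<open>T\<close>.\<close>

definition damp :: "'i set \<Rightarrow> ('i \<Rightarrow> 'a) \<Rightarrow> 'i \<Rightarrow> 'a"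
  where "damp F x = (\<lambda>a. if a \<in> F
    then p a (x a) - (1 / real (card I)) *\<^sub>R p a (\<Sum>b\<in>F. p b (x b)) else 0)"

lemma damp_fixed_tuple: "F \<subseteq> I \<Longrightarrow> fixed_tuple (damp F x)"
  by (auto simp: fixed_tuple_def damp_def)

lemma damp_diff:
  assumes "F \<subseteq> I" shows "damp F (\<lambda>i. x i - y i) = (\<lambda>i. damp F x i - damp F y i)"
proof
  fix i
  have "(\<Sum>b\<in>F. p b (x b - y b)) = (\<Sum>b\<in>F. p b (x b)) - (\<Sum>b\<in>F. p b (y b))"
    using assms by (subst sum_subtractf[symmetric], intro sum.cong) auto
  then show "damp F (\<lambda>i. x i - y i) i = damp F x i - damp F y i"
    using assms by (auto simp: damp_def scaleR_diff_right)
qed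

text \<open>The inner projections in \<open>damp\<close> are invisible on fixed tuples. They belong
  to the definition so that every matrix entry of \<open>damp F\<close> is a combination of words in
  the letters.\<close>

lemma damp_eq:
  assumes "fixed_tuple x" "F \<subseteq> I" "a \<in> F"
  shows "damp F x a = x a - (1 / real (card I)) *\<^sub>R p a (\<Sum>b\<in>F. x b)"
proof -
  have "(\<Sum>b\<in>F. p b (x b)) = (\<Sum>b\<in>F. x b)" using assms by (intro sum.cong) (auto simp: fixed_tuple_def)
  then show ?thesis using assms by (auto simp: damp_def fixed_tuple_def)
qed

text \<open>With \<open>T\<close> the sum and \<open>r = card I\<close>, expanding the squares gives
  the cross term \<open>- 2 / r * (norm T)\<^sup>2\<close>, while the quadratic terms add up to at
  most \<open>card F / r\<^sup>2 * (norm T)\<^sup>2\<close>, hence to at most half of it in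
  size.\<close>

lemma damp_energy:
  assumes x: "fixed_tuple x" and F: "F \<subseteq> I"
  shows "(tuple_norm F (damp F x))\<^sup>2 \<le> (tuple_norm F x)\<^sup>2 - (norm (\<Sum>i\<in>F. x i))\<^sup>2 / real (card I)"
proof (cases "F = {}")
  case False
  define r where "r = real (card I)"
  define T where "T = (\<Sum>i\<in>F. x i)"
  have r: "r > 0" using False F finite_I unfolding r_def by (simp add: card_gt_0_iff) blast
  have card: "real (card F) \<le> r" unfolding r_def using F finite_I by (simp add: card_mono)
  have *: "(norm (damp F x a))\<^sup>2 \<le> (norm (x a))\<^sup>2 - (2 / r) * (x a \<bullet> T) + (norm T)\<^sup>2 / r\<^sup>2"
    if "a \<in> F" for a
  proof -
    have pa: "orth_proj (p a)" "p a (x a) = x a" using that F x proj by (auto simp: fixed_tuple_def)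
    have "(norm (damp F x a))\<^sup>2 = (norm (x a))\<^sup>2 - (2 / r) * (x a \<bullet> p a T) + (norm (p a T))\<^sup>2 / r\<^sup>2"
      unfolding damp_eq[OF x F that] T_def[symmetric] r_def[symmetric]
      by (simp add: power2_norm_eq_inner inner_diff_left inner_diff_right inner_commute)
        (simp add: power2_eq_square)
    moreover have "x a \<bullet> p a T = x a \<bullet> T" using pa orth_proj_sym[OF pa(1), of "x a" T] by simp
    moreover have "(norm (p a T))\<^sup>2 \<le> (norm T)\<^sup>2"
      using orth_proj_norm_le[OF pa(1)] by (simp add: power_mono)
    ultimately show ?thesis by (simp add: divide_right_mono)
  qed
  have "(tuple_norm F (damp F x))\<^sup>2
      \<le> (\<Sum>a\<in>F. (norm (x a))\<^sup>2 - (2 / r) * (x a \<bullet> T) + (norm T)\<^sup>2 / r\<^sup>2)"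
    unfolding tuple_norm_square by (rule sum_mono) (rule *)
  also have "\<dots> = (tuple_norm F x)\<^sup>2 - (2 / r) * (T \<bullet> T) + card F * ((norm T)\<^sup>2 / r\<^sup>2)"
  proof -
    have "(\<Sum>a\<in>F. (2 / r) * (x a \<bullet> T)) = (2 / r) * ((\<Sum>a\<in>F. x a) \<bullet> T)"
      by (simp only: inner_sum_left sum_distrib_left)
    then show ?thesis
      by (simp only: sum.distrib sum_subtractf tuple_norm_square T_def[symmetric] sum_constant)
  qed
  also have "\<dots> \<le> (tuple_norm F x)\<^sup>2 - (2 / r) * (T \<bullet> T) + r * ((norm T)\<^sup>2 / r\<^sup>2)"
    by (intro add_left_mono mult_right_mono card) simp
  also have "\<dots> = (tuple_norm F x)\<^sup>2 - (norm T)\<^sup>2 / r"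
    using r by (simp add: dot_square_norm power2_eq_square field_simps)
  finally show ?thesis unfolding T_def r_def .
qed (simp add: tuple_norm_def)

lemma damp_contraction:
  assumes "fixed_tuple x" "F \<subseteq> I" shows "tuple_norm F (damp F x) \<le> tuple_norm F x"
proof -
  have "(tuple_norm F (damp F x))\<^sup>2 \<le> (tuple_norm F x)\<^sup>2"
    using damp_energy[OF assms] by (smt (verit) divide_nonneg_nonneg of_nat_0_le_iff zero_le_power2)
  then show ?thesis by (rule power2_le_imp_le) simp
qed

text \<open>One step moves \<open>x\<close> by at most the norm of its sum. Since
  \<open>damp I\<close> is linear and contracts fixed tuples, later steps do not enlarge this
  displacement, so \<open>m\<close> steps cost at most \<open>m\<close> times as much.\<close>

lemma damp_approx:
  assumes x: "fixed_tuple x"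
  shows "tuple_norm I (\<lambda>a. (damp I ^^ m) x a - x a) \<le> real m * norm (\<Sum>i\<in>I. x i)"
proof (induction m)
  case (Suc m)
  have fx: "fixed_tuple ((damp I ^^ m) x)" using x by (cases m) (auto simp: damp_fixed_tuple)
  define z where "z = (\<lambda>a. (damp I ^^ m) x a - x a)"
  have z: "fixed_tuple z" unfolding z_def using fx x by (auto simp: fixed_tuple_def)
  define T where "T = (\<Sum>i\<in>I. x i)"
  have "tuple_norm I (\<lambda>a. damp I x a - x a) \<le> norm T"
  proof (subst tuple_norm_le_iff)
    have "(\<Sum>i\<in>I. (norm (damp I x i - x i))\<^sup>2) \<le> (\<Sum>i\<in>I. (norm T)\<^sup>2 / (real (card I))\<^sup>2)"
    proof (rule sum_mono)
      fix i assume i: "i \<in> I"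
      have "norm (damp I x i - x i) \<le> norm T / real (card I)"
        using orth_proj_norm_le[OF proj[OF i], of T] damp_eq[OF x order.refl i]
        by (simp add: T_def divide_right_mono)
      then show "(norm (damp I x i - x i))\<^sup>2 \<le> (norm T)\<^sup>2 / (real (card I))\<^sup>2"
        by (metis power_divide power_mono norm_ge_zero)
    qed
    also have "\<dots> = real (card I) * ((norm T)\<^sup>2 / (real (card I))\<^sup>2)" by simp
    also have "\<dots> \<le> (norm T)\<^sup>2"
    proof (cases "card I = 0")
      case False
      have "real (card I) * ((norm T)\<^sup>2 / (real (card I))\<^sup>2) = (norm T)\<^sup>2 / real (card I)"
        by (simp add: power2_eq_square)
      also have "\<dots> \<le> (norm T)\<^sup>2 / 1" using False by (intro divide_left_mono) auto
      finally show ?thesis by simp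
    qed simp
    finally show "(\<Sum>i\<in>I. (norm (damp I x i - x i))\<^sup>2) \<le> (norm T)\<^sup>2" .
  qed simp
  moreover have "tuple_norm I (damp I z) \<le> real m * norm T"
    using damp_contraction[OF z order.refl] Suc.IH unfolding z_def T_def by linarith
  moreover have "damp I z = (\<lambda>a. (damp I ^^ Suc m) x a - damp I x a)"
    unfolding z_def by (simp add: damp_diff)
  ultimately show ?case
    using tuple_norm_triangle[of I "(damp I ^^ Suc m) x" x "damp I x"]
    unfolding T_def by (simp add: algebra_simps)
qed simp

lemma damp_relation:
  assumes "fixed_tuple y" "F \<subseteq> I" "(\<Sum>i\<in>F. y i) = 0" "a \<in> F"
  shows "damp F y a = y a"
  using damp_eq[OF assms(1,2,4)] assms by auto

lemma fixed_tuple_diff: "fixed_tuple x \<Longrightarrow> fixed_tuple y \<Longrightarrow> fixed_tuple (\<lambda>i. x i - y i)"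
  by (auto simp: fixed_tuple_def)

text \<open>Geometric decay of the squared distance to the exact relations. Damping fixes relations,
  so it never increases the distance to the current one. The relation may change from step to step,
  so no orthogonal projection onto the kernel has to exist.\<close>

lemma damp_iterate:
  assumes x: "fixed_tuple x" and F: "F \<subseteq> I" "F \<noteq> {}" and C: "C \<ge> 1"
    and st: "stable_sum F (\<lambda>i. fixed_points (p i)) C"
  shows "\<exists>y. fixed_tuple y \<and> (\<forall>i. i \<notin> F \<longrightarrow> y i = 0) \<and> (\<Sum>i\<in>F. y i) = 0 \<and>
    (tuple_norm F (\<lambda>i. (damp F ^^ m) x i - y i))\<^sup>2
      \<le> (1 - 1 / (2 * real (card I) * C\<^sup>2)) ^ m * (tuple_norm F x)\<^sup>2"
proof (induction m)
  case 0
  show ?case by (intro exI[of _ "\<lambda>_. 0"]) (auto simp: fixed_tuple_def)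
next
  case (Suc m)
  define r where "r = real (card I)"
  have r: "r \<ge> 1" using F finite_I unfolding r_def
    by (metis One_nat_def Suc_leI card_gt_0_iff of_nat_1 of_nat_mono subset_empty)
  define q where "q = 1 - 1 / (2 * r * C\<^sup>2)"
  have rC: "2 * r * C\<^sup>2 \<ge> 2" using mult_mono[OF r one_le_power[OF C, of 2]] r by simp
  define z where "z = (damp F ^^ m) x"
  have z: "fixed_tuple z" unfolding z_def using x F by (cases m) (auto simp: damp_fixed_tuple)
  define e where "e = q ^ m * (tuple_norm F x)\<^sup>2"
  define T where "T = norm (\<Sum>i\<in>F. z i)"
  obtain y where y: "fixed_tuple y" "\<And>i. i \<notin> F \<Longrightarrow> y i = 0" "(\<Sum>i\<in>F. y i) = 0"
    and ye: "(tuple_norm F (\<lambda>i. z i - y i))\<^sup>2 \<le> e"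
    using Suc.IH unfolding z_def e_def q_def r_def by blast
  have e: "e \<ge> 0" using ye by (smt (verit) zero_le_power2)
  have key: "(tuple_norm F (\<lambda>i. damp F z i - y' i))\<^sup>2
      \<le> (tuple_norm F (\<lambda>i. z i - y' i))\<^sup>2 - T\<^sup>2 / r"
    if y': "fixed_tuple y'" "(\<Sum>i\<in>F. y' i) = 0" for y'
  proof -
    have "tuple_norm F (\<lambda>i. damp F z i - y' i) = tuple_norm F (damp F (\<lambda>i. z i - y' i))"
      using F y' by (intro tuple_norm_cong) (simp add: damp_diff damp_relation)
    then show ?thesis using damp_energy[OF fixed_tuple_diff[OF z y'(1)] F(1)] y'(2)
      by (simp add: sum_subtractf T_def r_def)
  qed
  have "\<exists>y. fixed_tuple y \<and> (\<forall>i. i \<notin> F \<longrightarrow> y i = 0) \<and> (\<Sum>i\<in>F. y i) = 0 \<and>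
    (tuple_norm F (\<lambda>i. damp F z i - y i))\<^sup>2 \<le> q * e"
  \<comment> \<open>If the sum is large, the old relation is kept and the energy loss
    \<open>T\<^sup>2 / r\<close> supplies the factor \<open>q\<close>. If it is small, stability
    supplies a new relation at squared distance at most
    \<open>C\<^sup>2 * T\<^sup>2 \<le> e / 2\<close>, which suffices because
    \<open>q \<ge> 1/2\<close>.\<close>
  proof (cases "T\<^sup>2 \<ge> e / (2 * C\<^sup>2)")
    case True
    have "(tuple_norm F (\<lambda>i. damp F z i - y i))\<^sup>2 \<le> e - T\<^sup>2 / r"
      using key[OF y(1,3)] ye by linarith
    also have "\<dots> \<le> e - e / (2 * C\<^sup>2) / r"
      using True r by (intro diff_left_mono divide_right_mono) auto
    also have "\<dots> = q * e" unfolding q_def by (simp add: field_simps)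
    finally show ?thesis using y by blast
  next
    case False
    have "\<forall>i\<in>F. z i \<in> fixed_points (p i)" using z F by (auto simp: fixed_tuple_def fixed_points_def)
    then obtain y0 where y0: "\<forall>i\<in>F. y0 i \<in> fixed_points (p i)" "(\<Sum>i\<in>F. y0 i) = 0"
        "tuple_norm F (\<lambda>i. z i - y0 i) \<le> C * T"
      using st unfolding stable_sum_def T_def by blast
    define y' where "y' i = (if i \<in> F then y0 i else 0)" for i
    have y': "fixed_tuple y'" "(\<Sum>i\<in>F. y' i) = 0"
      using y0 by (auto simp: y'_def fixed_tuple_def fixed_points_def)
    have "tuple_norm F (\<lambda>i. z i - y' i) \<le> C * T"
      using y0(3) unfolding y'_def by (simp cong: tuple_norm_cong)
    then have "(tuple_norm F (\<lambda>i. z i - y' i))\<^sup>2 \<le> C\<^sup>2 * T\<^sup>2"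
      by (metis power_mono power_mult_distrib tuple_norm_nonneg)
    also have "\<dots> \<le> C\<^sup>2 * (e / (2 * C\<^sup>2))" using False by (intro mult_left_mono) auto
    also have "\<dots> = e / 2" using C by simp
    also have "\<dots> \<le> q * e"
    proof -
      have "q \<ge> 1/2" unfolding q_def using rC by (simp add: field_simps)
      from mult_right_mono[OF this e] show ?thesis by simp
    qed
    finally have "(tuple_norm F (\<lambda>i. damp F z i - y' i))\<^sup>2 \<le> q * e"
      using key[OF y'] r by (smt (verit) divide_nonneg_nonneg zero_le_power2)
    then show ?thesis using y' by (intro exI[of _ y']) (auto simp: y'_def)
  qed
  then show ?case unfolding z_def e_def q_def r_def by (simp add: mult.assoc)
qed

end

section \<open>Words in projections\<close>

primrec word_prod :: "('i \<Rightarrow> 'a \<Rightarrow> 'a) \<Rightarrow> 'i list \<Rightarrow> 'a \<Rightarrow> 'a" where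
  "word_prod q [] v = v"
| "word_prod q (i # w) v = q i (word_prod q w v)"

lemma word_prod_append: "word_prod q (w @ w') v = word_prod q w (word_prod q w' v)"
  by (induction w) auto

text \<open>Sequences of operators on tuples whose matrix entries are fixed linear combinations of
  words in the letters \<open>p n i\<close> that contain every letter of \<open>S\<close>. These play the role of the
  intersection over \<open>S\<close> of the ideals generated by the individual letters.\<close>

inductive word_op :: "(nat \<Rightarrow> 'i \<Rightarrow> 'a::real_vector \<Rightarrow> 'a) \<Rightarrow> 'i set \<Rightarrow> 'i set
    \<Rightarrow> (nat \<Rightarrow> ('i \<Rightarrow> 'a) \<Rightarrow> 'i \<Rightarrow> 'a) \<Rightarrow> bool"
  for p I S where
  zero: "word_op p I S (\<lambda>n x c. 0)"
| entry: "a \<in> I \<Longrightarrow> b \<in> I \<Longrightarrow> S \<subseteq> set w \<Longrightarrow> set w \<subseteq> I \<Longrightarrow>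
    word_op p I S (\<lambda>n x c. if c = a then word_prod (p n) w (x b) else 0)"
| scale: "word_op p I S f \<Longrightarrow> word_op p I S (\<lambda>n x c. s *\<^sub>R f n x c)"
| add: "word_op p I S f \<Longrightarrow> word_op p I S g \<Longrightarrow> word_op p I S (\<lambda>n x c. f n x c + g n x c)"

lemma word_op_diff:
  assumes "word_op p I S f" "word_op p I S g" shows "word_op p I S (\<lambda>n x c. f n x c - g n x c)"
  using word_op.add[OF assms(1) word_op.scale[OF assms(2), of "-1"]] by simp

lemma word_op_sum:
  "(\<And>k. k \<in> K \<Longrightarrow> word_op p I S (f k)) \<Longrightarrow> word_op p I S (\<lambda>n x c. \<Sum>k\<in>K. f k n x c)"
  by (induction K rule: infinite_finite_induct) (auto intro: word_op.zero word_op.add)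

locale projection_sequence =
  fixes I :: "'i set" and p :: "nat \<Rightarrow> 'i \<Rightarrow> 'a::real_inner \<Rightarrow> 'a"
  assumes finite: "finite I" and orth: "\<And>n i. i \<in> I \<Longrightarrow> orth_proj (p n i)"
begin

sublocale projections I "p n" for n
  using finite orth by unfold_locales

lemma linear_word_prod: "set w \<subseteq> I \<Longrightarrow> linear (word_prod (p n) w)"
  by (induction w) (auto intro!: linearI simp: linear_add linear_scale)

lemma word_prod_simps:
  assumes "set w \<subseteq> I"
  shows "word_prod (p n) w 0 = 0"
    "word_prod (p n) w (u + v) = word_prod (p n) w u + word_prod (p n) w v"
    "word_prod (p n) w (s *\<^sub>R v) = s *\<^sub>R word_prod (p n) w v"
  using linear_word_prod[OF assms] by (simp_all add: linear_0 linear_add linear_scale)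

text \<open>Composition either concatenates two words, which unites their sets of letters, or meets
  two matrix units that do not match and gives zero.\<close>

lemma word_op_comp:
  assumes f: "word_op p I S f" and g: "word_op p I S' g"
  shows "word_op p I (S \<union> S') (\<lambda>n x. f n (g n x))"
  using f
proof (induction rule: word_op.induct)
  case (entry a b w)
  from g show ?case
  proof (induction rule: word_op.induct)
    case zero
    show ?case using word_prod_simps[OF entry(4)] by (simp add: word_op.zero cong: if_cong)
  next
    case (entry a' b' w')
    show ?case
    proof (cases "b = a'")
      case True
      have "word_op p I (S \<union> S') (\<lambda>n x c. if c = a then word_prod (p n) (w @ w') (x b') else 0)"
        using \<open>a \<in> I\<close> entry \<open>S \<subseteq> set w\<close> \<open>set w \<subseteq> I\<close> by (intro word_op.entry) auto
      then show ?thesis using True by (simp add: word_prod_append cong: if_cong)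
    next
      case False
      then show ?thesis using word_prod_simps[OF \<open>set w \<subseteq> I\<close>]
        by (simp add: word_op.zero cong: if_cong)
    qed
  next
    case (scale f s)
    have "(\<lambda>n x c. if c = a then word_prod (p n) w (s *\<^sub>R f n x b) else 0) =
        (\<lambda>n x c. s *\<^sub>R (if c = a then word_prod (p n) w (f n x b) else 0))"
      using word_prod_simps[OF \<open>set w \<subseteq> I\<close>] by (intro ext) simp
    then show ?case using word_op.scale[OF scale.IH, of s] by simp
  next
    case (add f g)
    have "(\<lambda>n x c. if c = a then word_prod (p n) w (f n x b + g n x b) else 0) =
        (\<lambda>n x c. (if c = a then word_prod (p n) w (f n x b) else 0) +
          (if c = a then word_prod (p n) w (g n x b) else 0))"
      using word_prod_simps[OF \<open>set w \<subseteq> I\<close>] by (intro ext) simp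
    then show ?case using word_op.add[OF add.IH] by simp
  qed
qed (auto intro: word_op.intros)

text \<open>The words and their coefficients do not depend on \<open>n\<close>, so the bound is a
  finite combination of null sequences. The generating words use exactly the letters of
  \<open>I\<close>, which is why decay is required for those words only.\<close>

lemma word_op_null:
  assumes f: "word_op p I I f"
    and w: "\<And>w. set w = I \<Longrightarrow> \<exists>e. e \<longlonglongrightarrow> 0 \<and> (\<forall>n v. norm (word_prod (p n) w v) \<le> e n * norm v)"
  shows "\<exists>e. e \<longlonglongrightarrow> (0::real) \<and> (\<forall>n. e n \<ge> 0) \<and> (\<forall>n x. tuple_norm I (f n x) \<le> e n * tuple_norm I x)"
  using f
proof (induction rule: word_op.induct)
  case zero
  show ?case by (intro exI[of _ "\<lambda>_. 0"]) simp
next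
  case (entry a b w)
  then have "set w = I" by auto
  from w[OF this] obtain e where e: "e \<longlonglongrightarrow> 0" "\<And>n v. norm (word_prod (p n) w v) \<le> e n * norm v"
    by blast
  have "tuple_norm I (\<lambda>c. if c = a then word_prod (p n) w (x b) else 0) \<le> \<bar>e n\<bar> * tuple_norm I x"
    for n x
  proof -
    have "norm (word_prod (p n) w (x b)) \<le> \<bar>e n\<bar> * norm (x b)"
      using e(2)[of n "x b"] by (smt (verit) mult_right_mono norm_ge_zero)
    also have "\<dots> \<le> \<bar>e n\<bar> * tuple_norm I x"
      using entry finite by (intro mult_left_mono norm_le_tuple_norm) auto
    finally show ?thesis using entry finite by (simp add: tuple_norm_single)
  qed
  then show ?case using tendsto_rabs_zero[OF e(1)] by (intro exI[of _ "\<lambda>n. \<bar>e n\<bar>"]) auto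
next
  case (scale f s)
  then obtain e where "e \<longlonglongrightarrow> 0" "\<And>n. e n \<ge> 0" "\<And>n x. tuple_norm I (f n x) \<le> e n * tuple_norm I x"
    by blast
  then show ?case using tendsto_mult_right_zero[of e sequentially "\<bar>s\<bar>"]
    by (intro exI[of _ "\<lambda>n. \<bar>s\<bar> * e n"]) (auto simp: tuple_norm_scaleR mult.assoc intro: mult_left_mono)
next
  case (add f g)
  then obtain e e' where e: "e \<longlonglongrightarrow> 0" "\<And>n. e n \<ge> 0" "\<And>n x. tuple_norm I (f n x) \<le> e n * tuple_norm I x"
    and e': "e' \<longlonglongrightarrow> 0" "\<And>n. e' n \<ge> 0" "\<And>n x. tuple_norm I (g n x) \<le> e' n * tuple_norm I x"
    by blast
  have "tuple_norm I (\<lambda>c. f n x c + g n x c) \<le> (e n + e' n) * tuple_norm I x" for n x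
    using tuple_norm_add[of I "f n x" "g n x"] e(3)[of n x] e'(3)[of n x]
    by (simp add: distrib_right)
  then show ?case using tendsto_add[OF e(1) e'(1)] e(2) e'(2)
    by (intro exI[of _ "\<lambda>n. e n + e' n"]) auto
qed

lemma damp_expand:
  assumes F: "F \<subseteq> I"
  shows "damp n F x c = (\<Sum>a\<in>F. if c = a then word_prod (p n) [a] (x a) else 0) -
    (\<Sum>(a, b)\<in>F \<times> F. (1 / real (card I)) *\<^sub>R (if c = a then word_prod (p n) [a, b] (x b) else 0))"
proof -
  have fin: "finite F" using F finite finite_subset by blast
  show ?thesis
  proof (cases "c \<in> F")
    case True
    have "(\<Sum>(a, b)\<in>F \<times> F. (1 / real (card I)) *\<^sub>R (if c = a then word_prod (p n) [a, b] (x b) else 0))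
        = (\<Sum>b\<in>F. \<Sum>a\<in>F. if c = a then (1 / real (card I)) *\<^sub>R p n a (p n b (x b)) else 0)"
      unfolding sum.cartesian_product[symmetric]
      by (subst sum.swap) (intro sum.cong refl, simp)
    also have "\<dots> = (\<Sum>b\<in>F. (1 / real (card I)) *\<^sub>R p n c (p n b (x b)))"
      using fin True by simp
    also have "\<dots> = (1 / real (card I)) *\<^sub>R p n c (\<Sum>b\<in>F. p n b (x b))"
      using p_linear[of c n] True F by (simp add: linear_sum subset_iff scaleR_sum_right)
    finally show ?thesis using fin True by (simp add: damp_def)
  next
    case False
    then have "(\<Sum>a\<in>F. if c = a then word_prod (p n) [a] (x a) else 0) = 0"
      "(\<Sum>(a, b)\<in>F \<times> F. (1 / real (card I)) *\<^sub>R (if c = a then word_prod (p n) [a, b] (x b) else 0)) = 0"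
      by (auto intro!: sum.neutral)
    then show ?thesis using False by (simp add: damp_def)
  qed
qed

lemma word_op_damp:
  assumes F: "F \<subseteq> I" shows "word_op p I {} (\<lambda>n. damp n F)"
proof -
  have "word_op p I {} (\<lambda>n x c. (\<Sum>a\<in>F. if c = a then word_prod (p n) [a] (x a) else 0) -
    (\<Sum>k\<in>F \<times> F. (1 / real (card I)) *\<^sub>R
      (if c = fst k then word_prod (p n) [fst k, snd k] (x (snd k)) else 0)))"
    using F by (intro word_op_diff word_op_sum word_op.scale word_op.entry) auto
  also have "(\<lambda>n x c. (\<Sum>a\<in>F. if c = a then word_prod (p n) [a] (x a) else 0) -
    (\<Sum>k\<in>F \<times> F. (1 / real (card I)) *\<^sub>R
      (if c = fst k then word_prod (p n) [fst k, snd k] (x (snd k)) else 0))) = (\<lambda>n. damp n F)"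
    by (intro ext) (simp add: damp_expand[OF F] case_prod_beta cong: if_cong)
  finally show ?thesis .
qed

text \<open>Both operators are normalised by the same \<open>card I\<close>, so all words without
  \<open>j\<close> cancel. There remain the word \<open>[j]\<close> and the words of length two in
  which \<open>j\<close> occurs.\<close>

lemma word_op_damp_diff:
  assumes j: "j \<in> I"
  shows "word_op p I {j} (\<lambda>n x c. damp n I x c - damp n (I - {j}) x c)"
proof -
  let ?A = "\<lambda>n x c k. (1 / real (card I)) *\<^sub>R
      (if c = fst k then word_prod (p n) [fst k, snd k] (x (snd k)) else 0)"
  have "word_op p I {j} (\<lambda>n x c. (if c = j then word_prod (p n) [j] (x j) else 0) -
    (\<Sum>k\<in>I \<times> I - (I - {j}) \<times> (I - {j}). ?A n x c k))"
    using j by (intro word_op_diff word_op_sum word_op.scale word_op.entry) auto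
  also have "(\<lambda>n x c. (if c = j then word_prod (p n) [j] (x j) else 0) -
    (\<Sum>k\<in>I \<times> I - (I - {j}) \<times> (I - {j}). ?A n x c k)) =
    (\<lambda>n x c. damp n I x c - damp n (I - {j}) x c)"
  proof (intro ext)
    fix n x c
    have 1: "(\<Sum>k\<in>I \<times> I - (I - {j}) \<times> (I - {j}). ?A n x c k) =
        (\<Sum>k\<in>I \<times> I. ?A n x c k) - (\<Sum>k\<in>(I - {j}) \<times> (I - {j}). ?A n x c k)"
      using finite by (intro sum_diff) auto
    have 2: "(\<Sum>a\<in>I. if c = a then word_prod (p n) [a] (x a) else 0) =
        (if c = j then word_prod (p n) [j] (x j) else 0) +
        (\<Sum>a\<in>I - {j}. if c = a then word_prod (p n) [a] (x a) else 0)"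
      using finite j by (rule sum.remove)
    show "(if c = j then word_prod (p n) [j] (x j) else 0) -
        (\<Sum>k\<in>I \<times> I - (I - {j}) \<times> (I - {j}). ?A n x c k) = damp n I x c - damp n (I - {j}) x c"
      unfolding 1 damp_expand[OF order.refl] damp_expand[OF Diff_subset] 2 case_prod_beta
      by (simp only: algebra_simps)
  qed
  finally show ?thesis .
qed

lemma word_op_comp_power:
  assumes f: "word_op p I S f" and F: "F \<subseteq> I"
  shows "word_op p I S (\<lambda>n x. f n ((damp n F ^^ m) x))"
proof (induction m)
  case (Suc m)
  from word_op_comp[OF Suc word_op_damp[OF F]] show ?case by (simp add: funpow_swap1)
qed (simp add: f)

text \<open>Telescoping: with \<open>A\<close> and \<open>B\<close> the two damping operators,
  A^(m+1) - B^(m+1) = A (A^m - B^m) + (A - B) B^m, and every summand has a factor that contributes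
  the letter \<open>j\<close>.\<close>

lemma word_op_power_diff:
  assumes j: "j \<in> I"
  shows "word_op p I {j} (\<lambda>n x c. (damp n I ^^ m) x c - (damp n (I - {j}) ^^ m) x c)"
proof (induction m)
  case 0
  show ?case by (simp add: word_op.zero)
next
  case (Suc m)
  have 1: "word_op p I {j} (\<lambda>n x. damp n I (\<lambda>c. (damp n I ^^ m) x c - (damp n (I - {j}) ^^ m) x c))"
    using word_op_comp[OF word_op_damp[OF order.refl] Suc] by simp
  have 2: "word_op p I {j} (\<lambda>n x c. damp n I ((damp n (I - {j}) ^^ m) x) c -
      damp n (I - {j}) ((damp n (I - {j}) ^^ m) x) c)"
    using word_op_comp_power[OF word_op_damp_diff[OF j] Diff_subset] .
  show ?case using word_op.add[OF 1 2] by (simp add: damp_diff)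
qed

end

section \<open>Powers of the damping operators and the removal of one index\<close>

lemma (in projections) damp_power_outside: "m > 0 \<Longrightarrow> a \<notin> F \<Longrightarrow> (damp F ^^ m) x a = 0"
  by (cases m) (simp_all add: damp_def)

lemma (in projections) damp_power_fixed_tuple: "fixed_tuple x \<Longrightarrow> F \<subseteq> I \<Longrightarrow> fixed_tuple ((damp F ^^ m) x)"
  by (cases m) (simp_all add: damp_fixed_tuple)

lemma (in projections) damp_power_contraction:
  assumes "fixed_tuple x" "F \<subseteq> I" shows "tuple_norm F ((damp F ^^ m) x) \<le> tuple_norm F x"
proof (induction m)
  case (Suc m)
  then show ?case
    using damp_contraction[OF damp_power_fixed_tuple[OF assms, of m] assms(2)] by simp
qed simp

lemma (in projections) damp_power_diff:
  assumes "F \<subseteq> I"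
  shows "(damp F ^^ m) (\<lambda>i. x i - y i) = (\<lambda>i. (damp F ^^ m) x i - (damp F ^^ m) y i)"
  by (induction m) (simp_all add: damp_diff[OF assms])

lemma tuple_norm_supported:
  assumes "finite I" "F \<subseteq> I" "\<And>i. i \<in> I - F \<Longrightarrow> x i = 0"
  shows "tuple_norm I x = tuple_norm F x"
  unfolding tuple_norm_def L2_set_def using assms
  by (intro arg_cong[of _ _ sqrt] sum.mono_neutral_right) auto

context projections
begin

text \<open>This is the operator M_j of the overview, with the exponent \<open>m\<close>
  explicit.\<close>

definition kill :: "nat \<Rightarrow> 'i \<Rightarrow> ('i \<Rightarrow> 'a) \<Rightarrow> 'i \<Rightarrow> 'a"
  where "kill m j x = (\<lambda>c. (damp I ^^ m) x c - (damp (I - {j}) ^^ m) x c)"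

lemma kill_fixed_tuple: "fixed_tuple x \<Longrightarrow> fixed_tuple (kill m j x)"
  unfolding kill_def by (intro fixed_tuple_diff damp_power_fixed_tuple) auto

lemma kill_diff: "kill m j (\<lambda>i. x i - y i) = (\<lambda>i. kill m j x i - kill m j y i)"
  unfolding kill_def by (simp add: damp_power_diff algebra_simps)

lemma tuple_norm_damp_power_remove:
  assumes "fixed_tuple x" "m > 0"
  shows "tuple_norm I ((damp (I - {j}) ^^ m) x) \<le> tuple_norm I x"
proof -
  have "tuple_norm I ((damp (I - {j}) ^^ m) x) = tuple_norm (I - {j}) ((damp (I - {j}) ^^ m) x)"
    using finite_I assms(2) by (intro tuple_norm_supported) (auto simp: damp_power_outside)
  also have "\<dots> \<le> tuple_norm (I - {j}) x" by (rule damp_power_contraction[OF assms(1)]) auto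
  also have "\<dots> \<le> tuple_norm I x" using finite_I by (intro tuple_norm_subset) auto
  finally show ?thesis .
qed

lemma kill_norm:
  assumes "fixed_tuple x" "m > 0" shows "tuple_norm I (kill m j x) \<le> 2 * tuple_norm I x"
  using tuple_norm_diff[of I "(damp I ^^ m) x" "(damp (I - {j}) ^^ m) x"]
    damp_power_contraction[OF assms(1) order.refl, of m] tuple_norm_damp_power_remove[OF assms, of j]
  unfolding kill_def by linarith

text \<open>Take \<open>x' = x - y\<close> for a relation \<open>y\<close> near the damped tuple on
  \<open>I - {j}\<close>. Then \<open>x' - kill m j x\<close> is the sum of the displacement under
  \<open>damp I\<close>, bounded by \<open>damp_approx\<close>, and the distance of the other power
  to \<open>y\<close>, bounded by \<open>damp_iterate\<close>. The factor 3 comes from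
  \<open>y\<close> having norm at most twice that of \<open>x\<close>.\<close>

lemma kill_approx:
  assumes x: "fixed_tuple x" and m: "m > 0" and C: "C \<ge> 1"
    and st: "stable_sum (I - {j}) (\<lambda>i. fixed_points (p i)) C"
    and \<theta>: "0 \<le> \<theta>" "\<theta> \<le> 1" "(1 - 1 / (2 * real (card I) * C\<^sup>2)) ^ m \<le> \<theta>\<^sup>2"
  shows "\<exists>x'. fixed_tuple x' \<and> (\<Sum>i\<in>I. x' i) = (\<Sum>i\<in>I. x i) \<and> tuple_norm I x' \<le> 3 * tuple_norm I x \<and>
    tuple_norm I (\<lambda>i. x' i - kill m j x i) \<le> real m * norm (\<Sum>i\<in>I. x i) + \<theta> * tuple_norm I x"
proof -
  define F where "F = I - {j}"
  have F: "F \<subseteq> I" "finite F" using finite_I by (auto simp: F_def)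
  have "\<exists>y. fixed_tuple y \<and> (\<forall>i. i \<notin> F \<longrightarrow> y i = 0) \<and> (\<Sum>i\<in>F. y i) = 0 \<and>
    (tuple_norm F (\<lambda>i. (damp F ^^ m) x i - y i))\<^sup>2
      \<le> (1 - 1 / (2 * real (card I) * C\<^sup>2)) ^ m * (tuple_norm F x)\<^sup>2"
  proof (cases "F = {}")
    case True
    then show ?thesis
      by (intro exI[of _ "\<lambda>_. 0"]) (simp add: fixed_tuple_def tuple_norm_def)
  next
    case False
    then show ?thesis using damp_iterate[OF x F(1) _ C] st unfolding F_def by blast
  qed
  then obtain y where y: "fixed_tuple y" "\<And>i. i \<notin> F \<Longrightarrow> y i = 0" "(\<Sum>i\<in>F. y i) = 0"
    and ye: "(tuple_norm F (\<lambda>i. (damp F ^^ m) x i - y i))\<^sup>2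
      \<le> (1 - 1 / (2 * real (card I) * C\<^sup>2)) ^ m * (tuple_norm F x)\<^sup>2"
    by blast
  have "(tuple_norm F (\<lambda>i. (damp F ^^ m) x i - y i))\<^sup>2 \<le> (\<theta> * tuple_norm F x)\<^sup>2"
    using ye mult_right_mono[OF \<theta>(3), of "(tuple_norm F x)\<^sup>2"] by (simp add: power_mult_distrib)
  then have "tuple_norm F (\<lambda>i. (damp F ^^ m) x i - y i) \<le> \<theta> * tuple_norm F x"
    by (rule power2_le_imp_le) (simp add: \<theta>)
  also have "\<dots> \<le> \<theta> * tuple_norm I x"
    using finite_I F \<theta> by (intro mult_left_mono tuple_norm_subset) auto
  \<comment> \<open>Outside \<open>F\<close> both \<open>y\<close> and the damped tuple vanish, the
    latter because \<open>m > 0\<close>: the zeroth power would leave the entry at \<open>j\<close>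
    in place.\<close>
  also have "tuple_norm F (\<lambda>i. (damp F ^^ m) x i - y i) = tuple_norm I (\<lambda>i. (damp F ^^ m) x i - y i)"
    using finite_I F y m by (intro tuple_norm_supported[symmetric]) (auto simp: damp_power_outside)
  finally have err: "tuple_norm I (\<lambda>i. (damp F ^^ m) x i - y i) \<le> \<theta> * tuple_norm I x" .
  have "tuple_norm I y \<le> tuple_norm I ((damp F ^^ m) x) + \<theta> * tuple_norm I x"
    using tuple_norm_le[of I y "(damp F ^^ m) x"] err by (simp add: tuple_norm_minus)
  also have "\<dots> \<le> 2 * tuple_norm I x"
    using tuple_norm_damp_power_remove[OF x m, of j] mult_right_mono[OF \<theta>(2), of "tuple_norm I x"]
    unfolding F_def by simp
  finally have ny: "tuple_norm I y \<le> 2 * tuple_norm I x" .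
  define x' where "x' i = x i - y i" for i
  have "(\<Sum>i\<in>I. y i) = 0"
    using y finite_I F by (subst sum.mono_neutral_right[of I F]) auto
  then have "(\<Sum>i\<in>I. x' i) = (\<Sum>i\<in>I. x i)" by (simp add: x'_def sum_subtractf)
  moreover have "fixed_tuple x'" unfolding x'_def using x y by (intro fixed_tuple_diff)
  moreover have "tuple_norm I x' \<le> 3 * tuple_norm I x"
    unfolding x'_def using tuple_norm_diff[of I x y] ny by simp
  moreover have "tuple_norm I (\<lambda>i. x' i - kill m j x i)
      \<le> real m * norm (\<Sum>i\<in>I. x i) + \<theta> * tuple_norm I x"
  proof -
    have "tuple_norm I (\<lambda>i. x' i - kill m j x i) =
        tuple_norm I (\<lambda>i. (x i - (damp I ^^ m) x i) + ((damp F ^^ m) x i - y i))"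
      by (intro tuple_norm_cong) (simp add: x'_def kill_def F_def)
    also have "\<dots> \<le> tuple_norm I (\<lambda>i. x i - (damp I ^^ m) x i) + \<theta> * tuple_norm I x"
      using tuple_norm_add[of I "\<lambda>i. x i - (damp I ^^ m) x i" "\<lambda>i. (damp F ^^ m) x i - y i"] err
      by linarith
    also have "tuple_norm I (\<lambda>i. x i - (damp I ^^ m) x i) \<le> real m * norm (\<Sum>i\<in>I. x i)"
      using damp_approx[OF x, of m] by (subst tuple_norm_minus)
    finally show ?thesis by simp
  qed
  ultimately show ?thesis by blast
qed

text \<open>Each further index contributes a new error and, by \<open>kill_norm\<close>, at most
  doubles the old one, which gives the factor 3 per index. The sum of the tuple never changes, so
  all errors are measured against the same sum.\<close>

lemma kill_list_approx:
  assumes m: "m > 0" and C: "C \<ge> 1"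
    and st: "\<And>j. j \<in> I \<Longrightarrow> stable_sum (I - {j}) (\<lambda>i. fixed_points (p i)) C"
    and \<theta>: "0 \<le> \<theta>" "\<theta> \<le> 1" "(1 - 1 / (2 * real (card I) * C\<^sup>2)) ^ m \<le> \<theta>\<^sup>2"
    and x: "fixed_tuple x" and js: "set js \<subseteq> I"
  shows "\<exists>x'. fixed_tuple x' \<and> (\<Sum>i\<in>I. x' i) = (\<Sum>i\<in>I. x i) \<and>
    tuple_norm I x' \<le> 3 ^ length js * tuple_norm I x \<and>
    tuple_norm I (\<lambda>i. x' i - foldr (kill m) js x i)
      \<le> 3 ^ length js * (real m * norm (\<Sum>i\<in>I. x i) + \<theta> * tuple_norm I x)"
  using js
proof (induction js)
  case Nil
  then show ?case using x \<theta> by (intro exI[of _ x]) auto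
next
  case (Cons j js)
  define T where "T = (\<Sum>i\<in>I. x i)"
  define E where "E = real m * norm T + \<theta> * tuple_norm I x"
  define k where "k = (3::real) ^ length js"
  have k: "k \<ge> 1" by (simp add: k_def)
  define z where "z = foldr (kill m) js x"
  have z: "fixed_tuple z" unfolding z_def using x by (induction js) (auto intro: kill_fixed_tuple)
  obtain x1 where x1: "fixed_tuple x1" "(\<Sum>i\<in>I. x1 i) = T" "tuple_norm I x1 \<le> k * tuple_norm I x"
      "tuple_norm I (\<lambda>i. x1 i - z i) \<le> k * E"
    using Cons unfolding T_def z_def k_def E_def by auto
  obtain x2 where x2: "fixed_tuple x2" "(\<Sum>i\<in>I. x2 i) = T" "tuple_norm I x2 \<le> 3 * tuple_norm I x1"
      "tuple_norm I (\<lambda>i. x2 i - kill m j x1 i) \<le> real m * norm T + \<theta> * tuple_norm I x1"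
    using kill_approx[OF x1(1) m C st[of j] \<theta>] Cons.prems x1(2) by auto
  have "real m * norm T + \<theta> * tuple_norm I x1 \<le> real m * norm T + \<theta> * (k * tuple_norm I x)"
    using x1(3) \<theta> by (intro add_left_mono mult_left_mono)
  also have "\<dots> \<le> k * E"
    using mult_right_mono[OF k, of "real m * norm T"] by (simp add: E_def algebra_simps)
  finally have a: "tuple_norm I (\<lambda>i. x2 i - kill m j x1 i) \<le> k * E" using x2(4) by linarith
  have "tuple_norm I (\<lambda>i. kill m j x1 i - kill m j z i) \<le> 2 * tuple_norm I (\<lambda>i. x1 i - z i)"
    using kill_norm[OF fixed_tuple_diff[OF x1(1) z] m, of j] by (simp add: kill_diff)
  with a x1(4) have "tuple_norm I (\<lambda>i. x2 i - kill m j z i) \<le> 3 * k * E"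
    using tuple_norm_triangle[of I x2 "kill m j z" "kill m j x1"] by linarith
  moreover have "tuple_norm I x2 \<le> 3 * k * tuple_norm I x"
    using x2(3) x1(3) by simp
  ultimately show ?case using x2(1,2) unfolding z_def k_def E_def T_def by auto
qed

text \<open>Iterating leaves at most a geometric remainder plus \<open>2 * K\<close> times the norm
  of the sum. If the sum is nonzero, finitely many steps push the remainder below its norm, whence
  the extra 1 and no limit of tuples; if it is zero, \<open>x\<close> is already a relation.\<close>

lemma stable_sum_of_halving:
  assumes K: "K \<ge> 0"
    and half: "\<And>x. fixed_tuple x \<Longrightarrow> \<exists>x'. fixed_tuple x' \<and> (\<Sum>i\<in>I. x' i) = (\<Sum>i\<in>I. x i) \<and>
      tuple_norm I x' \<le> tuple_norm I x / 2 + K * norm (\<Sum>i\<in>I. x i)"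
  shows "stable_sum I (\<lambda>i. fixed_points (p i)) (2 * K + 1)"
  unfolding stable_sum_def
proof (intro allI impI)
  fix x assume "\<forall>i\<in>I. x i \<in> fixed_points (p i)"
  then have x: "fixed_tuple x" by (simp add: fixed_tuple_def fixed_points_def)
  define T where "T = (\<Sum>i\<in>I. x i)"
  show "\<exists>y. (\<forall>i\<in>I. y i \<in> fixed_points (p i)) \<and> (\<Sum>i\<in>I. y i) = 0 \<and>
    tuple_norm I (\<lambda>i. x i - y i) \<le> (2 * K + 1) * norm (\<Sum>i\<in>I. x i)"
  proof (cases "T = 0")
    case True
    then show ?thesis using x unfolding T_def
      by (intro exI[of _ x]) (simp add: fixed_tuple_def fixed_points_def)
  next
    case False
    have iter: "\<exists>x'. fixed_tuple x' \<and> (\<Sum>i\<in>I. x' i) = T \<and>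
        tuple_norm I x' \<le> (1/2) ^ t * tuple_norm I x + 2 * K * norm T" for t
    proof (induction t)
      case 0
      then show ?case using x K T_def by (intro exI[of _ x]) simp
    next
      case (Suc t)
      then obtain x1 where x1: "fixed_tuple x1" "(\<Sum>i\<in>I. x1 i) = T"
          "tuple_norm I x1 \<le> (1/2) ^ t * tuple_norm I x + 2 * K * norm T" by blast
      from half[OF x1(1)] obtain x2 where "fixed_tuple x2" "(\<Sum>i\<in>I. x2 i) = T"
          "tuple_norm I x2 \<le> tuple_norm I x1 / 2 + K * norm T" using x1(2) by auto
      moreover have "tuple_norm I x1 / 2 \<le> ((1/2) ^ t * tuple_norm I x + 2 * K * norm T) / 2"
        using x1(3) by (rule divide_right_mono) simp
      moreover have "((1/2) ^ t * tuple_norm I x + 2 * K * norm T) / 2 + K * norm T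
          = (1/2) ^ Suc t * tuple_norm I x + 2 * K * norm T" by (simp add: field_simps)
      ultimately have "tuple_norm I x2 \<le> (1/2) ^ Suc t * tuple_norm I x + 2 * K * norm T"
        by (metis add_le_cancel_right order.trans)
      then show ?case using \<open>fixed_tuple x2\<close> \<open>(\<Sum>i\<in>I. x2 i) = T\<close> by blast
    qed
    have "(\<lambda>t. (1/2) ^ t * tuple_norm I x) \<longlonglongrightarrow> 0"
      by (intro tendsto_mult_left_zero LIMSEQ_power_zero) simp
    then have "\<forall>\<^sub>F t in sequentially. (1/2) ^ t * tuple_norm I x < norm T"
      using False by (intro order_tendstoD(2)) auto
    then obtain t where t: "(1/2) ^ t * tuple_norm I x < norm T"
      using eventually_happens trivial_limit_sequentially by blast
    obtain x' where x': "fixed_tuple x'" "(\<Sum>i\<in>I. x' i) = T"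
        "tuple_norm I x' \<le> (1/2) ^ t * tuple_norm I x + 2 * K * norm T"
      using iter by blast
    have "tuple_norm I (\<lambda>i. x i - (x i - x' i)) \<le> (2 * K + 1) * norm T"
      using x'(3) t by (simp add: distrib_right)
    moreover have "(\<Sum>i\<in>I. x i - x' i) = 0" using x'(2) by (simp add: sum_subtractf T_def)
    moreover have "\<forall>i\<in>I. x i - x' i \<in> fixed_points (p i)"
      using fixed_tuple_diff[OF x x'(1)] by (simp add: fixed_tuple_def fixed_points_def)
    ultimately show ?thesis unfolding T_def by (intro exI[of _ "\<lambda>i. x i - x' i"] conjI)
  qed
qed

end

section \<open>Stability with one constant at all large levels\<close>

context projection_sequence
begin

lemma word_op_kill_list:
  assumes "js \<noteq> []" "set js \<subseteq> I"
  shows "word_op p I (set js) (\<lambda>n. foldr (kill n m) js)"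
  using assms
proof (induction js rule: list_nonempty_induct)
  case (single j)
  then show ?case using word_op_power_diff[of j m] by (simp add: kill_def[abs_def])
next
  case (cons j js)
  then have "word_op p I ({j} \<union> set js) (\<lambda>n x. kill n m j (foldr (kill n m) js x))"
    using word_op_power_diff[of j m] by (intro word_op_comp) (simp_all add: kill_def[abs_def])
  then show ?case by (simp add: comp_def)
qed

text \<open>Up to an exact relation and an error controlled by the sum, a tuple is close to the
  result of applying \<open>kill\<close> for every index. That result is a combination of words with
  all letters and hence small for large \<open>n\<close>, so the tuple can be halved.\<close>

lemma eventually_stable_sum:
  assumes "I \<noteq> {}"
    and w: "\<And>w. set w = I \<Longrightarrow> \<exists>e. e \<longlonglongrightarrow> 0 \<and> (\<forall>n v. norm (word_prod (p n) w v) \<le> e n * norm v)"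
    and st: "\<And>j. j \<in> I \<Longrightarrow> \<exists>C. \<forall>n. stable_sum (I - {j}) (\<lambda>i. fixed_points (p n i)) C"
  shows "\<exists>C N. \<forall>n\<ge>N. stable_sum I (\<lambda>i. fixed_points (p n i)) C"
proof -
  obtain c where c: "\<And>j n. j \<in> I \<Longrightarrow> stable_sum (I - {j}) (\<lambda>i. fixed_points (p n i)) (c j)"
    using st by metis
  define C where "C = 1 + (\<Sum>j\<in>I. \<bar>c j\<bar>)"
  have C: "C \<ge> 1" by (simp add: C_def sum_nonneg)
  have "c j \<le> C" if "j \<in> I" for j
    using member_le_sum[of j I "\<lambda>j. \<bar>c j\<bar>"] that finite unfolding C_def by fastforce
  then have st: "stable_sum (I - {j}) (\<lambda>i. fixed_points (p n i)) C" if "j \<in> I" for j n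
    using stable_sum_mono c that by blast
  obtain js where js: "set js = I" using finite_list[OF finite] by blast
  define L where "L = (3::real) ^ length js"
  have L: "L \<ge> 1" by (simp add: L_def)
  \<comment> \<open>The errors collected along \<open>js\<close> carry the factor \<open>L\<close>,
    so this choice makes their part proportional to the tuple norm equal to 1/4. The decaying words
    contribute another 1/4, which together is the required half.\<close>
  define \<theta> where "\<theta> = 1 / (4 * L)"
  have \<theta>: "\<theta> > 0" "\<theta> \<le> 1" "L * \<theta> = 1 / 4" using L by (auto simp: \<theta>_def field_simps)
  define r where "r = real (card I)"
  have r: "r \<ge> 1" unfolding r_def using assms(1) finite
    by (metis One_nat_def Suc_leI card_gt_0_iff of_nat_1 of_nat_mono)
  define q where "q = 1 - 1 / (2 * r * C\<^sup>2)"
  have "2 * r * C\<^sup>2 \<ge> 2" using mult_mono[OF r one_le_power[OF C, of 2]] r by simp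
  then have q: "0 \<le> q" "q < 1" by (auto simp: q_def field_simps)
  have "(\<lambda>m. q ^ m) \<longlonglongrightarrow> 0" using q by (intro LIMSEQ_power_zero) auto
  then have "\<forall>\<^sub>F m in sequentially. q ^ m < \<theta>\<^sup>2"
    using \<theta> by (intro order_tendstoD(2)) auto
  then have "\<forall>\<^sub>F m in sequentially. q ^ m < \<theta>\<^sup>2 \<and> m > 0"
    using eventually_gt_at_top[of 0] by eventually_elim simp
  \<comment> \<open>The square of \<theta> appears because \<open>damp_iterate\<close> bounds
    squared norms. The exponent is chosen before \<open>n\<close>: the operator must be one fixed
    combination of words for \<open>word_op_null\<close> to apply.\<close>
  then obtain m where m: "q ^ m < \<theta>\<^sup>2" "m > 0"
    using eventually_happens trivial_limit_sequentially by blast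
  have "js \<noteq> []" using js assms(1) by auto
  from word_op_null[OF word_op_kill_list[OF this, unfolded js, OF order.refl, of m] w]
  obtain e where e: "e \<longlonglongrightarrow> (0::real)" "\<And>n. e n \<ge> 0"
      "\<And>n x. tuple_norm I (foldr (kill n m) js x) \<le> e n * tuple_norm I x" by blast
  have "\<forall>\<^sub>F n in sequentially. e n < 1 / 4" using e(1) by (intro order_tendstoD(2)) auto
  then obtain N where N: "\<And>n. n \<ge> N \<Longrightarrow> e n < 1 / 4" by (auto simp: eventually_sequentially)
  have "stable_sum I (\<lambda>i. fixed_points (p n i)) (2 * (L * real m) + 1)" if n: "n \<ge> N" for n
  proof (rule stable_sum_of_halving)
    fix x assume x: "fixed_tuple n x"
    obtain x' where x': "fixed_tuple n x'" "(\<Sum>i\<in>I. x' i) = (\<Sum>i\<in>I. x i)"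
      "tuple_norm I (\<lambda>i. x' i - foldr (kill n m) js x i)
        \<le> L * (real m * norm (\<Sum>i\<in>I. x i) + \<theta> * tuple_norm I x)"
      using kill_list_approx[OF m(2) C st less_imp_le[OF \<theta>(1)] \<theta>(2)
          less_imp_le[OF m(1)[unfolded q_def r_def]] x, where js = js] js
      unfolding L_def by blast
    have "tuple_norm I (foldr (kill n m) js x) \<le> 1 / 4 * tuple_norm I x"
      using e(3)[of n x] mult_right_mono[of "e n" "1/4" "tuple_norm I x"] N[OF n] by simp
    moreover have "L * (real m * norm (\<Sum>i\<in>I. x i) + \<theta> * tuple_norm I x) =
        L * real m * norm (\<Sum>i\<in>I. x i) + 1 / 4 * tuple_norm I x"
      using \<theta>(3) by (simp add: distrib_left flip: mult.assoc)
    ultimately have "tuple_norm I x' \<le> tuple_norm I x / 2 + L * real m * norm (\<Sum>i\<in>I. x i)"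
      using x'(3) tuple_norm_le[of I x' "foldr (kill n m) js x"] by linarith
    then show "\<exists>x'. fixed_tuple n x' \<and> (\<Sum>i\<in>I. x' i) = (\<Sum>i\<in>I. x i) \<and>
        tuple_norm I x' \<le> tuple_norm I x / 2 + L * real m * norm (\<Sum>i\<in>I. x i)"
      using x' by blast
  qed (use L in auto)
  then show ?thesis by blast
qed

end

section \<open>Tensor powers of matrices on the Fock space\<close>

abbreviation words :: "nat \<Rightarrow> 'd list set"
  where "words n \<equiv> {w. length w = n}"

lemma finite_words [simp]: "finite (words n :: 'd::finite list set)"
  using finite_lists_length_eq[of "UNIV :: 'd set" n] by simp

lemma sum_words_Suc:
  fixes f :: "'d::finite list \<Rightarrow> 'b::comm_monoid_add"
  shows "(\<Sum>w\<in>words (Suc n). f w) = (\<Sum>a\<in>UNIV. \<Sum>w\<in>words n. f (a # w))"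
proof -
  have "bij_betw (\<lambda>(a, w). a # w) (UNIV \<times> words n) (words (Suc n) :: 'd list set)"
    by (rule bij_betwI[of _ _ _ "\<lambda>w. (hd w, tl w)"]) (auto simp: length_Suc_conv)
  from sum.reindex_bij_betw[OF this, of f] show ?thesis
    by (simp add: sum.cartesian_product case_prod_beta)
qed

lemma sum_words_rotate:
  fixes f :: "'d::finite list \<Rightarrow> 'b::comm_monoid_add"
  shows "(\<Sum>w\<in>words n. f (rotate1 w)) = (\<Sum>w\<in>words n. f w)"
proof (rule sum.reindex_bij_betw)
  have "inj_on rotate1 (words n :: 'd list set)"
    using inj_rotate1 inj_on_subset by blast
  moreover have "rotate1 ` words n \<subseteq> (words n :: 'd list set)" by auto
  ultimately show "bij_betw rotate1 (words n :: 'd list set) (words n)"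
    unfolding bij_betw_def using endo_inj_surj finite_words by blast
qed

lift_definition level :: "nat \<Rightarrow> ('d::finite list \<Rightarrow> complex) \<Rightarrow> 'd fock" is
  "\<lambda>n h w. if length w = n then h w else 0"
proof -
  fix n and h :: "'d list \<Rightarrow> complex"
  show "(\<lambda>w. (cmod (if length w = n then h w else 0))\<^sup>2) summable_on UNIV"
    by (intro finite_nonzero_values_imp_summable_on finite_subset[OF _ finite_words[of n]]) auto
qed

lemma coeff_level: "coeff (level n h) w = (if length w = n then h w else 0)"
  by (simp add: level.rep_eq)

lemma coeff_simps [simp]:
  "coeff (0 :: 'd fock) w = 0"
  "coeff (f + g) w = coeff f w + coeff g w"
  "coeff (f - g) w = coeff f w - coeff g w"
  "coeff (- f) w = - coeff f w"
  "coeff (r *\<^sub>R f) w = r *\<^sub>R coeff f w"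
  "coeff (scaleC c f) w = c * coeff f w"
  by (simp_all add: zero_fock.rep_eq plus_fock.rep_eq minus_fock.rep_eq uminus_fock.rep_eq
      scaleR_fock.rep_eq scaleC.rep_eq)

definition graded :: "nat \<Rightarrow> 'd fock set"
  where "graded n = {f. \<forall>w. length w \<noteq> n \<longrightarrow> coeff f w = 0}"

lemma graded_eqI:
  "f \<in> graded n \<Longrightarrow> g \<in> graded n \<Longrightarrow> (\<And>w. length w = n \<Longrightarrow> coeff f w = coeff g w) \<Longrightarrow> f = g"
  by (rule fock_eqI) (metis (mono_tags, lifting) graded_def mem_Collect_eq)

lemma level_graded [simp]: "level n h \<in> graded n"
  by (simp add: graded_def coeff_level)

lemma component_graded [simp]: "component n f \<in> graded n"
  by (simp add: graded_def component.rep_eq)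

lemma subspace_graded: "subspace (graded n)"
  by (auto simp: subspace_def graded_def)

lemma inner_graded:
  fixes f g :: "'d::finite fock"
  assumes "f \<in> graded n \<or> g \<in> graded n"
  shows "f \<bullet> g = (\<Sum>w\<in>words n. coeff f w \<bullet> coeff g w)"
proof -
  have "f \<bullet> g = (\<Sum>\<^sub>\<infinity>w\<in>words n. coeff f w \<bullet> coeff g w)"
    unfolding inner_fock_def using assms
    by (intro infsum_cong_neutral) (auto simp: graded_def)
  then show ?thesis by simp
qed

lemma norm_graded:
  fixes f :: "'d::finite fock"
  assumes "f \<in> graded n"
  shows "(norm f)\<^sup>2 = (\<Sum>w\<in>words n. (cmod (coeff f w))\<^sup>2)"
  using inner_graded[of f n f] assms by (simp add: power2_norm_eq_inner)

text \<open>The span is the real one, so every word contributes two vectors, with coefficients 1 and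
  \<i>.\<close>

lemma graded_finite_dim: "\<exists>B. finite B \<and> (graded n :: 'd::finite fock set) \<subseteq> span B"
proof -
  define e where "e c w = level n (\<lambda>u. if u = w then c else 0)" for c and w :: "'d list"
  let ?B = "e 1 ` words n \<union> e \<i> ` words n"
  have "f \<in> span ?B" if f: "f \<in> graded n" for f
  proof -
    have "f = (\<Sum>w\<in>words n. Re (coeff f w) *\<^sub>R e 1 w + Im (coeff f w) *\<^sub>R e \<i> w)"
    proof (rule graded_eqI[OF f])
      show "(\<Sum>w\<in>words n. Re (coeff f w) *\<^sub>R e 1 w + Im (coeff f w) *\<^sub>R e \<i> w) \<in> graded n"
        by (intro subspace_sum subspace_add subspace_scale subspace_graded) (simp_all add: e_def)
      fix u :: "'d list" assume u: "length u = n"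
      have "coeff (\<Sum>w\<in>words n. Re (coeff f w) *\<^sub>R e 1 w + Im (coeff f w) *\<^sub>R e \<i> w) u =
          (\<Sum>w\<in>words n. if u = w then coeff f u else 0)"
        unfolding coeff_sum using u
        by (intro sum.cong) (auto simp: e_def coeff_level complex_eq_iff)
      then show "coeff f u = coeff (\<Sum>w\<in>words n. Re (coeff f w) *\<^sub>R e 1 w + Im (coeff f w) *\<^sub>R e \<i> w) u"
        using u by simp
    qed
    also have "\<dots> \<in> span ?B"
      by (intro span_sum span_add span_scale span_base) auto
    finally show ?thesis .
  qed
  then show ?thesis by (intro exI[of _ ?B]) auto
qed

text \<open>The matrix entry of the tensor product of the matrices in \<open>As\<close> at row word
  \<open>w\<close> and column word \<open>u\<close>. A list is used because the matrices at
  different positions will differ while the common part is split off.\<close>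

definition tensor_kernel :: "(complex ^ 'd ^ 'd) list \<Rightarrow> 'd list \<Rightarrow> 'd list \<Rightarrow> complex"
  where "tensor_kernel As w u = (\<Prod>k<length As. As ! k $ (w ! k) $ (u ! k))"

text \<open>Set to zero on all levels other than \<open>length As\<close>, so that its fixed points
  lie in that level automatically.\<close>

definition tensor_op :: "(complex ^ 'd ^ 'd) list \<Rightarrow> 'd::finite fock \<Rightarrow> 'd fock"
  where "tensor_op As f = level (length As) (\<lambda>w. \<Sum>u\<in>words (length As). tensor_kernel As w u * coeff f u)"

lemma coeff_tensor_op:
  "coeff (tensor_op As f) w =
    (if length w = length As then \<Sum>u\<in>words (length As). tensor_kernel As w u * coeff f u else 0)"
  by (simp add: tensor_op_def coeff_level)

lemma tensor_op_graded [simp]: "n = length As \<Longrightarrow> tensor_op As f \<in> graded n"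
  by (simp add: tensor_op_def)

lemma tensor_op_add: "tensor_op As (f + g) = tensor_op As f + tensor_op As g"
  and tensor_op_scaleC: "tensor_op As (scaleC c f) = scaleC c (tensor_op As f)"
  and tensor_op_scaleR: "tensor_op As (r *\<^sub>R f) = r *\<^sub>R tensor_op As f"
  by (rule fock_eqI; simp add: coeff_tensor_op algebra_simps sum.distrib sum_distrib_left
      scaleR_sum_right)+

lemma linear_tensor_op: "linear (tensor_op As)"
  by (intro linearI tensor_op_add tensor_op_scaleR)

lemma tensor_op_comp:
  fixes f :: "'d::finite fock"
  assumes "length As = length Bs"
  shows "tensor_op As (tensor_op Bs f) = tensor_op (map2 (**) As Bs) f"
proof (rule fock_eqI)
  fix w :: "'d list"
  let ?n = "length Bs"
  have *: "(\<Sum>u\<in>words ?n. tensor_kernel As w u * tensor_kernel Bs u v) =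
      tensor_kernel (map2 (**) As Bs) w v" for v
  proof -
    have "(\<Sum>u\<in>words ?n. tensor_kernel As w u * tensor_kernel Bs u v) =
      (\<Sum>u\<in>words ?n. \<Prod>k<?n. As ! k $ (w ! k) $ (u ! k) * Bs ! k $ (u ! k) $ (v ! k))"
      using assms by (simp add: tensor_kernel_def prod.distrib)
    also have "\<dots> = (\<Prod>k<?n. \<Sum>j\<in>UNIV. As ! k $ (w ! k) $ j * Bs ! k $ j $ (v ! k))"
      by (rule sum_lists_prod[of "\<lambda>k j. As ! k $ (w ! k) $ j * Bs ! k $ j $ (v ! k)"])
    also have "\<dots> = tensor_kernel (map2 (**) As Bs) w v"
      using assms by (simp add: tensor_kernel_def matrix_matrix_mult_def)
    finally show ?thesis .
  qed
  have "(\<Sum>u\<in>words ?n. tensor_kernel As w u * (\<Sum>v\<in>words ?n. tensor_kernel Bs u v * coeff f v)) =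
      (\<Sum>v\<in>words ?n. (\<Sum>u\<in>words ?n. tensor_kernel As w u * tensor_kernel Bs u v) * coeff f v)"
    unfolding sum_distrib_left sum_distrib_right
    by (subst sum.swap) (simp add: mult.assoc)
  then show "coeff (tensor_op As (tensor_op Bs f)) w = coeff (tensor_op (map2 (**) As Bs) f) w"
    using assms by (simp add: coeff_tensor_op *)
qed

definition hermitian :: "complex ^ 'd ^ 'd \<Rightarrow> bool"
  where "hermitian A \<longleftrightarrow> (\<forall>i j. A $ i $ j = cnj (A $ j $ i))"

definition proj_matrix :: "complex ^ 'd ^ 'd \<Rightarrow> bool"
  where "proj_matrix A \<longleftrightarrow> hermitian A \<and> A ** A = A"

lemma map2_mult_idem: "\<forall>A\<in>set As. A ** A = A \<Longrightarrow> map2 (**) As As = As"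
  by (induction As) auto

lemma tensor_op_sym:
  fixes f g :: "'d::finite fock"
  assumes "\<forall>A\<in>set As. hermitian A"
  shows "tensor_op As f \<bullet> g = f \<bullet> tensor_op As g"
proof -
  let ?n = "length As"
  have cnj: "cnj (tensor_kernel As w u) = tensor_kernel As u w" for u w
    unfolding tensor_kernel_def cnj_prod using assms
    by (intro prod.cong refl) (metis hermitian_def lessThan_iff nth_mem)
  have adj: "(k * x) \<bullet> y = x \<bullet> (cnj k * y)" for k x y :: complex
    by (simp add: inner_complex_def algebra_simps)
  have "tensor_op As f \<bullet> g = (\<Sum>w\<in>words ?n. \<Sum>u\<in>words ?n. (tensor_kernel As w u * coeff f u) \<bullet> coeff g w)"
    by (subst inner_graded[of _ ?n]) (simp_all add: coeff_tensor_op inner_sum_left)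
  also have "\<dots> = (\<Sum>u\<in>words ?n. \<Sum>w\<in>words ?n. coeff f u \<bullet> (tensor_kernel As u w * coeff g w))"
    by (subst sum.swap) (simp add: adj cnj)
  also have "\<dots> = f \<bullet> tensor_op As g"
    by (subst inner_graded[of _ ?n]) (simp_all add: coeff_tensor_op inner_sum_right)
  finally show ?thesis .
qed

lemma orth_proj_tensor_op:
  assumes "\<forall>A\<in>set As. proj_matrix A" shows "orth_proj (tensor_op As)"
  unfolding orth_proj_def
  using assms by (simp add: linear_tensor_op tensor_op_sym proj_matrix_def tensor_op_comp map2_mult_idem)

lemma tensor_kernel_Cons: "tensor_kernel (A # As) (a # w) (b # u) = A $ a $ b * tensor_kernel As w u"
  by (simp add: tensor_kernel_def prod.lessThan_Suc_shift del: prod.lessThan_Suc)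

lemma tensor_kernel_snoc:
  "length w = length As \<Longrightarrow> length u = length As \<Longrightarrow>
    tensor_kernel (As @ [A]) (w @ [a]) (u @ [b]) = A $ a $ b * tensor_kernel As w u"
  by (simp add: tensor_kernel_def nth_append)

text \<open>The power n+1 of \<open>T\<close> is \<open>T\<close> on the first letter, with the
  remaining word held fixed, after the power n on the remaining word, with the first letter held
  fixed. Each of the two is estimated separately and summed over what is fixed.\<close>

lemma tensor_kernel_power_bound:
  fixes T :: "complex ^ 'd ^ 'd"
  assumes T: "\<And>x. norm (T *v x) \<le> c * norm x" and c: "c \<ge> 0"
  shows "(\<Sum>w\<in>words n. (cmod (\<Sum>u\<in>words n. tensor_kernel (replicate n T) w u * h u))\<^sup>2)
    \<le> (c ^ n)\<^sup>2 * (\<Sum>u\<in>words n. (cmod (h u))\<^sup>2)"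
proof (induction n arbitrary: h)
  case 0
  then show ?case by (simp add: tensor_kernel_def)
next
  case (Suc n)
  define g where "g b w = (\<Sum>u\<in>words n. tensor_kernel (replicate n T) w u * h (b # u))" for b w
  have T2: "(\<Sum>a\<in>UNIV. (cmod (\<Sum>b\<in>UNIV. T $ a $ b * x b))\<^sup>2) \<le> c\<^sup>2 * (\<Sum>b\<in>UNIV. (cmod (x b))\<^sup>2)"
    for x :: "'d \<Rightarrow> complex"
  proof -
    have "(norm (T *v (\<chi> b. x b)))\<^sup>2 \<le> (c * norm (\<chi> b. x b))\<^sup>2"
      by (intro power_mono T) auto
    then show ?thesis
      by (simp add: norm_vec_def L2_set_def sum_nonneg matrix_vector_mult_def power_mult_distrib)
  qed
  have "(\<Sum>w\<in>words (Suc n). (cmod (\<Sum>u\<in>words (Suc n). tensor_kernel (replicate (Suc n) T) w u * h u))\<^sup>2)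
      = (\<Sum>a\<in>UNIV. \<Sum>w\<in>words n. (cmod (\<Sum>b\<in>UNIV. T $ a $ b * g b w))\<^sup>2)"
    by (simp add: sum_words_Suc tensor_kernel_Cons g_def sum_distrib_left mult.assoc)
  also have "\<dots> = (\<Sum>w\<in>words n. \<Sum>a\<in>UNIV. (cmod (\<Sum>b\<in>UNIV. T $ a $ b * g b w))\<^sup>2)"
    by (rule sum.swap)
  also have "\<dots> \<le> (\<Sum>w\<in>words n. c\<^sup>2 * (\<Sum>b\<in>UNIV. (cmod (g b w))\<^sup>2))"
    by (intro sum_mono T2)
  also have "\<dots> = c\<^sup>2 * (\<Sum>b\<in>UNIV. \<Sum>w\<in>words n. (cmod (g b w))\<^sup>2)"
    by (subst sum.swap) (simp add: sum_distrib_left)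
  also have "\<dots> \<le> c\<^sup>2 * (\<Sum>b\<in>UNIV. (c ^ n)\<^sup>2 * (\<Sum>u\<in>words n. (cmod (h (b # u)))\<^sup>2))"
    unfolding g_def by (intro mult_left_mono sum_mono Suc.IH) simp
  also have "\<dots> = (c ^ Suc n)\<^sup>2 * (\<Sum>u\<in>words (Suc n). (cmod (h u))\<^sup>2)"
    by (simp add: sum_words_Suc sum_distrib_left power_mult_distrib mult.assoc)
  finally show ?case .
qed

lemma tensor_op_power_norm:
  fixes T :: "complex ^ 'd ^ 'd" and f :: "'d fock"
  assumes T: "\<And>x. norm (T *v x) \<le> c * norm x" and c: "c \<ge> 0"
  shows "norm (tensor_op (replicate n T) f) \<le> c ^ n * norm f"
proof -
  have "(norm (tensor_op (replicate n T) f))\<^sup>2 \<le> (c ^ n)\<^sup>2 * (\<Sum>u\<in>words n. (cmod (coeff f u))\<^sup>2)"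
    using tensor_kernel_power_bound[OF assms, of n "coeff f"]
    by (simp add: norm_graded[of _ n] coeff_tensor_op)
  also have "\<dots> \<le> (c ^ n)\<^sup>2 * (\<Sum>\<^sub>\<infinity>u. (cmod (coeff f u))\<^sup>2)"
    by (intro mult_left_mono finite_sum_le_infsum sq_summable_coeff) auto
  also have "\<dots> = (c ^ n * norm f)\<^sup>2"
    by (simp add: norm_fock power_mult_distrib infsum_nonneg)
  finally show ?thesis by (rule power2_le_imp_le) (use c in simp)
qed

lemma tensor_op_tensor:
  fixes vs :: "(complex ^ 'd) list"
  assumes "length As = length vs"
  shows "tensor_op As (tensor vs) = tensor (map2 (*v) As vs)"
proof (rule fock_eqI)
  fix w :: "'d list"
  let ?n = "length vs"
  have "(\<Sum>u\<in>words ?n. tensor_kernel As w u * (\<Prod>i<?n. vs ! i $ (u ! i))) =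
      (\<Sum>u\<in>words ?n. \<Prod>k<?n. As ! k $ (w ! k) $ (u ! k) * vs ! k $ (u ! k))"
    using assms by (simp add: tensor_kernel_def prod.distrib)
  also have "\<dots> = (\<Prod>k<?n. \<Sum>j\<in>UNIV. As ! k $ (w ! k) $ j * vs ! k $ j)"
    by (rule sum_lists_prod[of "\<lambda>k j. As ! k $ (w ! k) $ j * vs ! k $ j"])
  finally show "coeff (tensor_op As (tensor vs)) w = coeff (tensor (map2 (*v) As vs)) w"
    using assms by (simp add: coeff_tensor_op tensor.rep_eq matrix_vector_mult_def)
qed

text \<open>For the converse inclusion, a fixed vector \<open>f\<close> equals its image under the
  tensor power of \<open>P\<close>, which expands into elementary tensors of columns of
  \<open>P\<close>. These columns lie in \<open>V\<close> because \<open>P ** P = P\<close>.\<close>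

lemma tensor_power_eq:
  assumes V: "V = {v. P *v v = v}" and P: "P ** P = P"
  shows "tensor_power n V = fixed_points (tensor_op (replicate n P))"
proof (intro equalityI subsetI)
  fix f assume "f \<in> tensor_power n V"
  then show "f \<in> fixed_points (tensor_op (replicate n P))"
    unfolding tensor_power_def
  proof (induction rule: cfock.span_induct_alt)
    case base
    show ?case by (simp add: fixed_points_def linear_0[OF linear_tensor_op])
  next
    case (step c x y)
    then obtain vs where vs: "x = tensor vs" "length vs = n" "set vs \<subseteq> V" by blast
    have "map2 (*v) (replicate n P) vs = vs"
      using vs(2,3) V by (intro nth_equalityI) (auto simp: subset_iff)
    then have "tensor_op (replicate n P) x = x"
      using vs by (simp add: tensor_op_tensor)
    then show ?case using step(2)
      by (simp add: fixed_points_def tensor_op_add tensor_op_scaleC)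
  qed
next
  fix f assume "f \<in> fixed_points (tensor_op (replicate n P))"
  then have f: "f = tensor_op (replicate n P) f" by (simp add: fixed_points_def)
  let ?t = "\<lambda>u. tensor (map (\<lambda>b. column b P) u)"
  have "f = (\<Sum>u\<in>words n. scaleC (coeff f u) (?t u))"
  proof (rule fock_eqI)
    fix w
    have "coeff f w = (if length w = n then \<Sum>u\<in>words n. tensor_kernel (replicate n P) w u * coeff f u else 0)"
      by (subst f) (simp add: coeff_tensor_op)
    also have "\<dots> = (\<Sum>u\<in>words n. coeff f u * coeff (?t u) w)"
      by (auto simp: tensor.rep_eq tensor_kernel_def column_def mult.commute intro!: sum.cong)
    finally show "coeff f w = coeff (\<Sum>u\<in>words n. scaleC (coeff f u) (?t u)) w"
      by (simp add: coeff_sum)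
  qed
  moreover have "column b P \<in> V" for b
    using arg_cong[OF P, of "column b"]
    by (simp add: V vec_eq_iff column_def matrix_matrix_mult_def matrix_vector_mult_def)
  then have "(\<Sum>u\<in>words n. scaleC (coeff f u) (?t u)) \<in> tensor_power n V"
    unfolding tensor_power_def
    by (intro cfock.span_sum cfock.span_scale cfock.span_base)
      (auto intro!: exI[of _ "map (\<lambda>b. column b P) u" for u])
  ultimately show "f \<in> tensor_power n V" by simp
qed

section \<open>Projection matrices\<close>

lemma matrix_diff_mult:
  fixes A B C :: "complex ^ 'd ^ 'd"
  shows "(A - B) ** C = A ** C - B ** C" "C ** (A - B) = C ** A - C ** B"
  by (simp_all add: vec_eq_iff matrix_matrix_mult_def algebra_simps sum_subtractf)

lemma proj_matrix_mat_1 [simp]: "proj_matrix (mat 1)"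
  unfolding proj_matrix_def matrix_mul_lid by (simp add: hermitian_def mat_def)

lemma inner_vec_scaleC: "((c::complex) *s a) \<bullet> b = a \<bullet> (cnj c *s b)"
  by (simp add: inner_vec_def inner_complex_def algebra_simps)

lemma orth_proj_proj_matrix:
  assumes "proj_matrix P" shows "orth_proj ((*v) P)"
proof -
  have herm: "cnj (P $ i $ j) = P $ j $ i" for i j
  proof -
    have "P $ j $ i = cnj (P $ i $ j)" using assms unfolding proj_matrix_def hermitian_def by blast
    then show ?thesis by (rule sym)
  qed
  have "(P *v x) \<bullet> y = x \<bullet> (P *v y)" for x y
  proof -
    have adj: "(k * a) \<bullet> b = a \<bullet> (cnj k * b)" for k a b :: complex
      by (simp add: inner_complex_def algebra_simps)
    have "(P *v x) \<bullet> y = (\<Sum>i\<in>UNIV. \<Sum>j\<in>UNIV. x $ j \<bullet> (cnj (P $ i $ j) * y $ i))"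
      by (simp add: inner_vec_def matrix_vector_mult_def inner_sum_left adj)
    also have "\<dots> = (\<Sum>j\<in>UNIV. \<Sum>i\<in>UNIV. x $ j \<bullet> (P $ j $ i * y $ i))"
      by (subst sum.swap) (simp only: herm)
    also have "\<dots> = x \<bullet> (P *v y)"
      by (simp add: inner_vec_def matrix_vector_mult_def inner_sum_right)
    finally show ?thesis .
  qed
  moreover have "linear ((*v) P)"
    by (intro linearI) (simp_all add: vec_eq_iff matrix_vector_mult_def algebra_simps sum.distrib scaleR_sum_right)
  ultimately show ?thesis
    using assms by (simp add: orth_proj_def proj_matrix_def matrix_vector_mul_assoc)
qed

text \<open>The decomposition is orthogonal for the real inner product. As \<open>V\<close> is
  stable under complex scalars, its real orthogonal complement is too, so by uniqueness the
  projection is complex linear and has a complex matrix.\<close>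

lemma proj_matrix_exists:
  fixes V :: "(complex ^ 'd) set"
  assumes V: "vec.subspace V"
  shows "\<exists>P. proj_matrix P \<and> V = {v. P *v v = v}"
proof -
  have scale: "c *s x \<in> V" if "x \<in> V" for c x using V that by (simp add: vec.subspace_def)
  have "c *\<^sub>R x = complex_of_real c *s x" for c and x :: "complex ^ 'd"
    by (simp add: vec_eq_iff complex_eq_iff)
  then have subV: "subspace V"
    using V by (simp add: subspace_def vec.subspace_def)
  then have "span V = V" by (simp add: span_eq_iff)
  have "\<exists>y. y \<in> V \<and> (\<forall>w\<in>V. (x - y) \<bullet> w = 0)" for x
  proof -
    obtain y z where "y \<in> span V" "\<And>w. w \<in> span V \<Longrightarrow> orthogonal z w" "x = y + z"
      by (rule orthogonal_subspace_decomp_exists[of V x]) blast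
    then show ?thesis using \<open>span V = V\<close> by (intro exI[of _ y]) (auto simp: orthogonal_def)
  qed
  then obtain p where p: "\<And>x. p x \<in> V" "\<And>x w. w \<in> V \<Longrightarrow> (x - p x) \<bullet> w = 0" by metis
  have uniq: "p x = y" if y: "y \<in> V" "\<And>w. w \<in> V \<Longrightarrow> (x - y) \<bullet> w = 0" for x y
  proof -
    have "(p x - y) \<bullet> (p x - y) = (x - y) \<bullet> (p x - y) - (x - p x) \<bullet> (p x - y)"
      by (simp add: inner_diff_left)
    also have "\<dots> = 0" using subspace_diff[OF subV p(1)[of x] y(1)] y(2) p(2) by simp
    finally show ?thesis by simp
  qed
  have "p (x + y) = p x + p y" for x y
  proof (rule uniq)
    show "p x + p y \<in> V" by (intro subspace_add subV p)
    show "(x + y - (p x + p y)) \<bullet> w = 0" if "w \<in> V" for w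
      using p(2)[OF that, of x] p(2)[OF that, of y] by (simp add: inner_diff_left inner_add_left)
  qed
  moreover have "p (c *s x) = c *s p x" for c x
  proof (rule uniq)
    show "c *s p x \<in> V" by (intro scale p)
    show "(c *s x - c *s p x) \<bullet> w = 0" if "w \<in> V" for w
      using p(2)[OF scale[OF that, of "cnj c"], of x]
      by (simp add: inner_vec_scaleC flip: vector_ssub_ldistrib)
  qed
  ultimately have "Vector_Spaces.linear (*s) (*s) p"
    by unfold_locales
  then have mp: "matrix p *v x = p x" for x by (rule matrix_works)
  have pV: "p x = x \<longleftrightarrow> x \<in> V" for x
    using uniq[of x x] p(1)[of x] by auto
  have idem: "matrix p ** matrix p = matrix p"
    by (simp add: matrix_eq mp pV p(1) flip: matrix_vector_mul_assoc)
  have sym: "p x \<bullet> y = x \<bullet> p y" for x y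
    using p(2)[OF p(1)[of y], of x] p(2)[OF p(1)[of x], of y]
    by (simp add: inner_diff_left inner_diff_right inner_commute)
  have "matrix p $ i $ j = cnj (matrix p $ j $ i)" for i j
  proof -
    have *: "p (axis b u) = (\<chi> a. u * matrix p $ a $ b)" for b u
    proof -
      have "(\<Sum>j\<in>UNIV. matrix p $ a $ j * axis b u $ j) = (\<Sum>j\<in>UNIV. if j = b then u * matrix p $ a $ b else 0)" for a
        by (intro sum.cong) (auto simp: axis_def)
      then have "matrix p *v axis b u = (\<chi> a. u * matrix p $ a $ b)"
        by (simp add: vec_eq_iff matrix_vector_mult_def)
      then show ?thesis unfolding mp .
    qed
    have "(u * matrix p $ i $ j) \<bullet> v = u \<bullet> (v * matrix p $ j $ i)" for u v
      using sym[of "axis j u" "axis i v"] unfolding *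
      by (simp add: inner_axis inner_axis')
    \<comment> \<open>Symmetry of the real inner product tested against 1 compares the real parts of
      the two entries, and tested against \<i> their imaginary parts.\<close>
    from this[of 1 1] this[of 1 \<i>] show ?thesis
      by (simp add: inner_complex_def complex_eq_iff)
  qed
  then have "hermitian (matrix p)" unfolding hermitian_def by blast
  then have "proj_matrix (matrix p)" using idem by (simp add: proj_matrix_def)
  moreover have "V = {v. matrix p *v v = v}" using pV by (simp add: mp)
  ultimately show ?thesis by blast
qed

lemma orth_proj_pythagoras:
  assumes "orth_proj f" shows "(norm v)\<^sup>2 = (norm (f v))\<^sup>2 + (norm (v - f v))\<^sup>2"
  using orth_proj_sym[OF assms, of v v] orth_proj_sym[OF assms, of "f v" v] orth_proj_idem[OF assms, of v]
  by (simp add: power2_norm_eq_inner inner_diff_left inner_diff_right inner_commute)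

lemma word_prod_norm_le:
  "\<forall>i\<in>set w. orth_proj (q i) \<Longrightarrow> norm (word_prod q w x) \<le> norm x"
  by (induction w) (auto intro: order.trans[OF orth_proj_norm_le])

text \<open>By Pythagoras a projection strictly shrinks every vector that it moves. If no norm is
  lost along the word, then, read from the right, each letter fixes \<open>x\<close>.\<close>

lemma word_prod_norm_eq:
  assumes "\<forall>i\<in>set w. orth_proj (q i)" "norm (word_prod q w x) = norm x"
  shows "\<forall>i\<in>set w. q i x = x"
  using assms
proof (induction w)
  case (Cons i w)
  let ?y = "word_prod q w x"
  have q: "orth_proj (q i)" using Cons.prems by simp
  have "norm (q i ?y) \<le> norm ?y" "norm ?y \<le> norm x"
    using orth_proj_norm_le[OF q] word_prod_norm_le[of w q x] Cons.prems(1) by simp_all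
  moreover have "norm (q i ?y) = norm x" using Cons.prems by simp
  ultimately have eq: "norm ?y = norm x" by linarith
  then have IH: "\<forall>k\<in>set w. q k x = x" using Cons by simp
  then have "?y = x" by (induction w) auto
  then have "norm (q i x) = norm x" using Cons.prems by simp
  then have "q i x = x" using orth_proj_pythagoras[OF q, of x] by simp
  then show ?case using IH by simp
qed simp

definition word_matrix :: "('i \<Rightarrow> complex ^ 'd ^ 'd) \<Rightarrow> 'i list \<Rightarrow> complex ^ 'd ^ 'd"
  where "word_matrix P w = foldr (\<lambda>i. (**) (P i)) w (mat 1)"

lemma word_matrix_vector: "word_matrix P w *v x = word_prod (\<lambda>i. (*v) (P i)) w x"
  by (induction w) (simp_all add: word_matrix_def flip: matrix_vector_mul_assoc)

text \<open>The word must be nonempty: the empty product is the identity on the whole Fock space,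
  whereas the right side would be the projection onto level \<open>n\<close>.\<close>

lemma word_prod_tensor_op:
  assumes "w \<noteq> []"
  shows "word_prod (\<lambda>i. tensor_op (replicate n (P i))) w f = tensor_op (replicate n (word_matrix P w)) f"
  using assms
proof (induction w rule: list_nonempty_induct)
  case (cons i w)
  then show ?case by (simp add: tensor_op_comp word_matrix_def zip_replicate)
qed (simp add: word_matrix_def)

text \<open>A word that preserves the norm of \<open>x\<close> has all its letters fixing
  \<open>x\<close>, so every nonzero vector shrinks strictly. Compactness of the unit sphere turns
  this into one factor \<open>c < 1\<close>.\<close>

lemma word_matrix_contraction:
  fixes P :: "'i \<Rightarrow> complex ^ 'd ^ 'd"
  assumes P: "\<forall>i\<in>set w. proj_matrix (P i)"
    and triv: "\<And>x. \<forall>i\<in>set w. P i *v x = x \<Longrightarrow> x = 0"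
  shows "\<exists>c. 0 \<le> c \<and> c < 1 \<and> (\<forall>x. norm (word_matrix P w *v x) \<le> c * norm x)"
proof -
  define T where "T = word_matrix P w"
  have lin: "linear ((*v) T)"
    by (intro linearI) (simp_all add: vec_eq_iff matrix_vector_mult_def algebra_simps sum.distrib scaleR_sum_right)
  have strict: "norm (T *v x) < norm x" if "x \<noteq> 0" for x
  proof -
    have q: "\<forall>i\<in>set w. orth_proj ((*v) (P i))" using P by (simp add: orth_proj_proj_matrix)
    have "norm (T *v x) \<noteq> norm x"
      using word_prod_norm_eq[OF q] triv that unfolding T_def word_matrix_vector by blast
    then show ?thesis using word_prod_norm_le[OF q, of x] unfolding T_def word_matrix_vector by simp
  qed
  have ne: "sphere (0 :: complex ^ 'd) 1 \<noteq> {}"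
    using vector_choose_size[of 1, where 'a = "complex ^ 'd"] by (auto simp: dist_norm)
  have "continuous_on (sphere 0 1) (\<lambda>x. norm (T *v x))"
    using lin by (intro continuous_intros linear_continuous_on) (simp add: linear_conv_bounded_linear)
  then obtain x0 where x0: "norm x0 = 1" "\<And>x. norm x = 1 \<Longrightarrow> norm (T *v x) \<le> norm (T *v x0)"
    using continuous_attains_sup[OF compact_sphere ne, of "\<lambda>x. norm (T *v x)"]
    by (auto simp: dist_norm)
  have "norm (T *v x) \<le> norm (T *v x0) * norm x" for x
  proof (cases "x = 0")
    case False
    have "norm (T *v ((1 / norm x) *\<^sub>R x)) \<le> norm (T *v x0)"
      using False by (intro x0) simp
    then show ?thesis using False by (simp add: linear_scale[OF lin] field_simps)
  qed (simp add: linear_0[OF lin])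
  moreover have "norm (T *v x0) < 1" using strict[of x0] x0(1) by fastforce
  ultimately show ?thesis unfolding T_def by (intro exI[of _ "norm (word_matrix P w *v x0)"]) auto
qed

section \<open>Splitting off the common part of the ranges\<close>

abbreviation tensor_range :: "(complex ^ 'd ^ 'd) list \<Rightarrow> 'd::finite fock set"
  where "tensor_range As \<equiv> fixed_points (tensor_op As)"

lemma tensor_range_graded: "f \<in> tensor_range As \<Longrightarrow> f \<in> graded (length As)"
  unfolding fixed_points_def mem_Collect_eq by (metis tensor_op_graded)

lemma tensor_range_comp:
  assumes f: "f \<in> tensor_range Bs" and eq: "length As = length Bs"
  shows "tensor_op As f = tensor_op (map2 (**) As Bs) f"
  using tensor_op_comp[OF eq, of f] f by (simp add: fixed_points_def)

lemma tensor_op_in_range: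
  "\<forall>A\<in>set As. proj_matrix A \<Longrightarrow> tensor_op As f \<in> tensor_range As"
  using orth_proj_tensor_op orth_proj_idem by (auto simp: fixed_points_def)

lemma map2_mult_mat_1 [simp]: "map2 (**) (replicate (length As) (mat 1)) As = As"
  "map2 (**) As (replicate (length As) (mat 1)) = As"
  by (induction As) auto

lemma subspace_fixed_points: "linear f \<Longrightarrow> subspace (fixed_points f)"
  by (auto simp: subspace_def fixed_points_def linear_0 linear_add linear_scale)

lemma stable_sum_transport:
  assumes st: "stable_sum I H' C" and C: "C \<ge> 0"
    and lin: "linear \<phi>" "linear \<psi>"
    and le: "\<And>v. norm (\<phi> v) \<le> norm v" "\<And>v. norm (\<psi> v) \<le> norm v"
    and H: "\<And>i v. i \<in> I \<Longrightarrow> v \<in> H i \<Longrightarrow> \<phi> v \<in> H' i" "\<And>i v. i \<in> I \<Longrightarrow> v \<in> H' i \<Longrightarrow> \<psi> v \<in> H i"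
    and inv: "\<And>i v. i \<in> I \<Longrightarrow> v \<in> H i \<Longrightarrow> \<psi> (\<phi> v) = v"
  shows "stable_sum I H C"
  unfolding stable_sum_def
proof (intro allI impI)
  fix x assume x: "\<forall>i\<in>I. x i \<in> H i"
  then have "\<forall>i\<in>I. \<phi> (x i) \<in> H' i" using H(1) by blast
  then obtain y where y: "\<forall>i\<in>I. y i \<in> H' i" "(\<Sum>i\<in>I. y i) = 0"
      "tuple_norm I (\<lambda>i. \<phi> (x i) - y i) \<le> C * norm (\<Sum>i\<in>I. \<phi> (x i))"
    using st[unfolded stable_sum_def, rule_format, of "\<lambda>i. \<phi> (x i)"] by auto
  have "tuple_norm I (\<lambda>i. x i - \<psi> (y i)) = tuple_norm I (\<lambda>i. \<psi> (\<phi> (x i) - y i))"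
    using x inv by (intro tuple_norm_cong) (simp add: linear_diff[OF lin(2)])
  also have "\<dots> \<le> tuple_norm I (\<lambda>i. \<phi> (x i) - y i)"
    unfolding tuple_norm_def by (intro L2_set_mono le) simp
  also have "\<dots> \<le> C * norm (\<phi> (\<Sum>i\<in>I. x i))" using y(3) by (simp add: linear_sum[OF lin(1)])
  also have "\<dots> \<le> C * norm (\<Sum>i\<in>I. x i)" using C le(1) by (rule mult_left_mono[rotated])
  finally have "tuple_norm I (\<lambda>i. x i - \<psi> (y i)) \<le> C * norm (\<Sum>i\<in>I. x i)" .
  moreover have "(\<Sum>i\<in>I. \<psi> (y i)) = \<psi> (\<Sum>i\<in>I. y i)" by (rule linear_sum[OF lin(2), symmetric])
  then have "(\<Sum>i\<in>I. \<psi> (y i)) = 0" by (simp only: y(2) linear_0[OF lin(2)])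
  moreover have "\<forall>i\<in>I. \<psi> (y i) \<in> H i" using y(1) H(2) by blast
  ultimately show "\<exists>y. (\<forall>i\<in>I. y i \<in> H i) \<and> (\<Sum>i\<in>I. y i) = 0 \<and>
      tuple_norm I (\<lambda>i. x i - y i) \<le> C * norm (\<Sum>i\<in>I. x i)"
    by (intro exI[of _ "\<lambda>i. \<psi> (y i)"] conjI)
qed

section \<open>Cyclic rotation of the tensor positions\<close>

definition rot :: "nat \<Rightarrow> 'd::finite fock \<Rightarrow> 'd fock"
  where "rot n f = level (Suc n) (\<lambda>w. coeff f (rotate1 w))"

definition unrot :: "nat \<Rightarrow> 'd::finite fock \<Rightarrow> 'd fock"
  where "unrot n f = level (Suc n) (\<lambda>w. coeff f (last w # butlast w))"

lemma linear_rot: "linear (rot n)" "linear (unrot n)"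
  unfolding rot_def unrot_def by (intro linearI fock_eqI; simp add: coeff_level)+

lemma last_butlast_rotate1: "w \<noteq> [] \<Longrightarrow> last (rotate1 w) # butlast (rotate1 w) = w"
  by (cases w) auto

lemma unrot_rot: "f \<in> graded (Suc n) \<Longrightarrow> unrot n (rot n f) = f"
  by (rule graded_eqI[of _ "Suc n"])
    (auto simp: unrot_def rot_def coeff_level append_butlast_last_id length_Suc_conv)

lemma rot_unrot: "f \<in> graded (Suc n) \<Longrightarrow> rot n (unrot n f) = f"
  by (rule graded_eqI[of _ "Suc n"])
    (auto simp: unrot_def rot_def coeff_level last_butlast_rotate1 length_Suc_conv)

lemma sum_words_le_norm:
  fixes f :: "'d::finite fock"
  shows "(\<Sum>u\<in>words n. (cmod (coeff f u))\<^sup>2) \<le> (norm f)\<^sup>2"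
proof -
  have "(\<Sum>u\<in>words n. (cmod (coeff f u))\<^sup>2) \<le> (\<Sum>\<^sub>\<infinity>u. (cmod (coeff f u))\<^sup>2)"
    by (intro finite_sum_le_infsum sq_summable_coeff) auto
  then show ?thesis by (simp add: norm_fock infsum_nonneg)
qed

lemma norm_rot_le: "norm (rot n f) \<le> norm f" "norm (unrot n f) \<le> norm f"
proof -
  have "(\<Sum>w\<in>words (Suc n). (cmod (coeff f (last w # butlast w)))\<^sup>2) =
      (\<Sum>w\<in>words (Suc n). (cmod (coeff f (last (rotate1 w) # butlast (rotate1 w))))\<^sup>2)"
    by (rule sum_words_rotate[symmetric])
  also have "\<dots> = (\<Sum>w\<in>words (Suc n). (cmod (coeff f w))\<^sup>2)"
    by (intro sum.cong) (auto simp: last_butlast_rotate1 length_Suc_conv)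
  finally have "(norm (unrot n f))\<^sup>2 \<le> (norm f)\<^sup>2"
    using sum_words_le_norm[of f "Suc n"] norm_graded[of "unrot n f" "Suc n"]
    by (simp add: unrot_def coeff_level)
  then show "norm (unrot n f) \<le> norm f" by (rule power2_le_imp_le) simp
  have "(norm (rot n f))\<^sup>2 \<le> (norm f)\<^sup>2"
    using sum_words_le_norm[of f "Suc n"] norm_graded[of "rot n f" "Suc n"]
    by (simp add: rot_def coeff_level sum_words_rotate[of "\<lambda>w. (cmod (coeff f w))\<^sup>2"])
  then show "norm (rot n f) \<le> norm f" by (rule power2_le_imp_le) simp
qed

text \<open>\<open>rot\<close> brings the last tensor factor to the front, and the matrices move
  along with it. Splitting is only carried out in the first position, and rotation makes the other
  positions accessible.\<close>

lemma tensor_op_rot: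
  assumes n: "length As = n"
  shows "tensor_op (A # As) (rot n f) = rot n (tensor_op (As @ [A]) f)"
proof (rule graded_eqI[of _ "Suc n"])
  fix w :: "'a list" assume w: "length w = Suc n"
  have "tensor_kernel (A # As) w u = tensor_kernel (As @ [A]) (rotate1 w) (rotate1 u)"
    if "length u = Suc n" for u
    using w n that by (cases w; cases u) (auto simp: tensor_kernel_Cons tensor_kernel_snoc)
  then have "coeff (tensor_op (A # As) (rot n f)) w =
      (\<Sum>u\<in>words (Suc n). tensor_kernel (As @ [A]) (rotate1 w) (rotate1 u) * coeff f (rotate1 u))"
    using w n by (simp add: coeff_tensor_op rot_def coeff_level)
  also have "\<dots> = (\<Sum>u\<in>words (Suc n). tensor_kernel (As @ [A]) (rotate1 w) u * coeff f u)"
    by (rule sum_words_rotate)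
  finally show "coeff (tensor_op (A # As) (rot n f)) w = coeff (rot n (tensor_op (As @ [A]) f)) w"
    using w n by (simp add: coeff_tensor_op rot_def coeff_level)
qed (use n in \<open>simp_all add: rot_def\<close>)

lemma stable_sum_rotate:
  assumes st: "stable_sum I (\<lambda>i. tensor_range (As i @ [A i])) C" and C: "C \<ge> 0"
    and n: "\<And>i. i \<in> I \<Longrightarrow> length (As i) = n"
  shows "stable_sum I (\<lambda>i. tensor_range (A i # As i)) C"
proof (rule stable_sum_transport[OF st C linear_rot(2,1) norm_rot_le(2,1)])
  fix i v assume i: "i \<in> I"
  {
    assume v: "v \<in> tensor_range (A i # As i)"
    then have g: "v \<in> graded (Suc n)" using tensor_range_graded[of v "A i # As i"] n[OF i] by simp
    then show "rot n (unrot n v) = v" by (rule rot_unrot)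
    have "rot n (tensor_op (As i @ [A i]) (unrot n v)) = v"
      using v rot_unrot[OF g] by (simp add: fixed_points_def flip: tensor_op_rot[OF n[OF i]])
    then have "unrot n v = unrot n (rot n (tensor_op (As i @ [A i]) (unrot n v)))" by simp
    also have "\<dots> = tensor_op (As i @ [A i]) (unrot n v)"
      using n[OF i] by (intro unrot_rot) simp
    finally show "unrot n v \<in> tensor_range (As i @ [A i])" by (simp add: fixed_points_def)
  }
  assume "v \<in> tensor_range (As i @ [A i])"
  then show "rot n v \<in> tensor_range (A i # As i)"
    by (simp add: fixed_points_def tensor_op_rot[OF n[OF i]])
qed

section \<open>Slices along the first tensor factor\<close>

definition slice :: "nat \<Rightarrow> 'd \<Rightarrow> 'd::finite fock \<Rightarrow> 'd fock"
  where "slice n a f = level n (\<lambda>w. coeff f (a # w))"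

text \<open>Reassembles a tensor of level n+1 from its slices, one tensor of level n for each
  possible first letter.\<close>

definition glue :: "nat \<Rightarrow> ('d \<Rightarrow> 'd::finite fock) \<Rightarrow> 'd fock"
  where "glue n g = level (Suc n) (\<lambda>w. coeff (g (hd w)) (tl w))"

lemma slice_graded [simp]: "slice n a f \<in> graded n"
  by (simp add: slice_def)

lemma glue_graded [simp]: "glue n g \<in> graded (Suc n)"
  by (simp add: glue_def)

lemma linear_slice: "linear (slice n a)"
  unfolding slice_def by (intro linearI fock_eqI; simp add: coeff_level)

lemma slice_glue: "g a \<in> graded n \<Longrightarrow> slice n a (glue n g) = g a"
  by (rule graded_eqI[of _ n]) (simp_all add: slice_def glue_def coeff_level)

lemma slice_eqI:
  assumes "f \<in> graded (Suc n)" "g \<in> graded (Suc n)" "\<And>a. slice n a f = slice n a g"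
  shows "f = g"
proof (rule graded_eqI[OF assms(1,2)])
  fix w :: "'a list" assume w: "length w = Suc n"
  then obtain a u where "w = a # u" "length u = n" by (auto simp: length_Suc_conv)
  then show "coeff f w = coeff g w"
    using arg_cong[OF assms(3), of "\<lambda>h. coeff h u" a] by (simp add: slice_def coeff_level)
qed

lemma norm_slices:
  fixes f :: "'d::finite fock"
  assumes "f \<in> graded (Suc n)" shows "(norm f)\<^sup>2 = (\<Sum>a\<in>UNIV. (norm (slice n a f))\<^sup>2)"
  using assms by (simp add: norm_graded sum_words_Suc) (simp add: norm_graded[of _ n] slice_def coeff_level)

lemma slice_tensor_op:
  assumes "length As = n"
  shows "slice n a (tensor_op (A # As) f) = (\<Sum>b\<in>UNIV. scaleC (A $ a $ b) (tensor_op As (slice n b f)))"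
proof (rule graded_eqI[of _ n])
  show "(\<Sum>b\<in>UNIV. scaleC (A $ a $ b) (tensor_op As (slice n b f))) \<in> graded n"
    using assms by (auto simp: graded_def coeff_sum coeff_tensor_op)
  fix w :: "'a list" assume "length w = n"
  then show "coeff (slice n a (tensor_op (A # As) f)) w =
      coeff (\<Sum>b\<in>UNIV. scaleC (A $ a $ b) (tensor_op As (slice n b f))) w"
    using assms by (simp add: slice_def coeff_level coeff_tensor_op coeff_sum sum_words_Suc
        tensor_kernel_Cons sum_distrib_left mult.assoc)
qed simp

lemma slice_in_range:
  assumes f: "f \<in> tensor_range (A # As)" and As: "\<forall>B\<in>set As. proj_matrix B" "length As = n"
  shows "slice n a f \<in> tensor_range As"
proof -
  have "slice n a f = (\<Sum>b\<in>UNIV. scaleC (A $ a $ b) (tensor_op As (slice n b f)))"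
    using f slice_tensor_op[OF As(2), of a A f] by (simp add: fixed_points_def)
  moreover have "tensor_op As \<dots> = \<dots>"
    using orth_proj_idem[OF orth_proj_tensor_op[OF As(1)]]
    by (simp add: linear_sum[OF linear_tensor_op] tensor_op_scaleC)
  ultimately show ?thesis by (simp add: fixed_points_def)
qed

lemma glue_in_range:
  assumes "\<And>a. g a \<in> tensor_range As" "length As = n"
  shows "glue n g \<in> tensor_range (mat 1 # As)"
  unfolding fixed_points_def mem_Collect_eq
proof (rule slice_eqI[of _ n])
  fix a
  have g: "g b \<in> graded n" for b using tensor_range_graded assms by blast
  have "slice n a (tensor_op (mat 1 # As) (glue n g)) =
      (\<Sum>b\<in>UNIV. scaleC (mat 1 $ a $ b) (tensor_op As (g b)))"
    by (simp add: slice_tensor_op[OF assms(2)] slice_glue g)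
  also have "\<dots> = (\<Sum>b\<in>UNIV. if b = a then g b else 0)"
    using assms(1) by (intro sum.cong) (auto simp: mat_def fixed_points_def)
  finally show "slice n a (tensor_op (mat 1 # As) (glue n g)) = slice n a (glue n g)"
    by (simp add: slice_glue g)
qed (use assms in simp_all)

text \<open>Stability is applied in each slice, and since squared norms add over slices, the
  constant survives. Gluing the slice relations leaves the first position unrestricted; the
  projection \<open>E\<close>, which is \<open>Q\<close> in that position, then restores it.
  \<open>E\<close> fixes every \<open>x i\<close> and does not increase norms, so the estimate is
  kept.\<close>

lemma stable_sum_Cons_common:
  fixes As :: "'i \<Rightarrow> (complex ^ 'd ^ 'd) list"
  assumes st: "stable_sum I (\<lambda>i. tensor_range (As i)) C" and C: "C \<ge> 0"
    and As: "\<And>i B. i \<in> I \<Longrightarrow> B \<in> set (As i) \<Longrightarrow> proj_matrix B" "\<And>i. i \<in> I \<Longrightarrow> length (As i) = n"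
    and Q: "proj_matrix Q"
  shows "stable_sum I (\<lambda>i. tensor_range (Q # As i)) C"
  unfolding stable_sum_def
proof (intro allI impI)
  fix x assume x: "\<forall>i\<in>I. x i \<in> tensor_range (Q # As i)"
  define E :: "'d fock \<Rightarrow> 'd fock" where "E = tensor_op (Q # replicate n (mat 1))"
  have E: "orth_proj E" unfolding E_def using Q by (intro orth_proj_tensor_op) auto
  have linE: "linear E" using E by (rule orth_proj_linear)
  have QQ: "Q ** Q = Q" using Q by (simp add: proj_matrix_def)
  have xg: "x i \<in> graded (Suc n)" if "i \<in> I" for i
    using tensor_range_graded[of "x i" "Q # As i"] x As(2)[OF that] that by simp
  define X where "X = (\<Sum>i\<in>I. x i)"
  have "\<exists>y. (\<forall>i\<in>I. y i \<in> tensor_range (As i)) \<and> (\<Sum>i\<in>I. y i) = 0 \<and>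
      tuple_norm I (\<lambda>i. slice n a (x i) - y i) \<le> C * norm (\<Sum>i\<in>I. slice n a (x i))" for a
  proof -
    have "\<forall>i\<in>I. slice n a (x i) \<in> tensor_range (As i)"
      using x As by (auto intro: slice_in_range)
    then show ?thesis using st[unfolded stable_sum_def, rule_format, of "\<lambda>i. slice n a (x i)"] by simp
  qed
  then obtain y where y: "\<And>a i. i \<in> I \<Longrightarrow> y a i \<in> tensor_range (As i)" "\<And>a. (\<Sum>i\<in>I. y a i) = 0"
      "\<And>a. tuple_norm I (\<lambda>i. slice n a (x i) - y a i) \<le> C * norm (\<Sum>i\<in>I. slice n a (x i))"
    by metis
  define z where "z i = glue n (\<lambda>a. y a i)" for i
  have yg: "y a i \<in> graded n" if "i \<in> I" for a i
    using tensor_range_graded[OF y(1)[OF that]] As(2)[OF that] by simp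
  have z1: "z i \<in> tensor_range (mat 1 # As i)" if "i \<in> I" for i
    unfolding z_def using y(1) As(2) that by (intro glue_in_range) auto
  have slz: "slice n a (z i) = y a i" if "i \<in> I" for a i
    unfolding z_def using yg[OF that] by (intro slice_glue)
  have "(\<Sum>i\<in>I. z i) = 0"
  proof (rule slice_eqI[of _ n])
    show "(\<Sum>i\<in>I. z i) \<in> graded (Suc n)"
      by (intro subspace_sum subspace_graded) (simp add: z_def)
    show "slice n a (\<Sum>i\<in>I. z i) = slice n a 0" for a
      using y(2)[of a] by (simp add: linear_sum[OF linear_slice] linear_0[OF linear_slice] slz)
  qed (simp add: graded_def)
  \<comment> \<open>\<open>E\<close> does not depend on \<open>i\<close>, so it maps relations to
    relations.\<close>
  then have sum0: "(\<Sum>i\<in>I. E (z i)) = 0"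
    by (simp flip: linear_sum[OF linE] add: linear_0[OF linE])
  have Ez: "E (z i) \<in> tensor_range (Q # As i)" if i: "i \<in> I" for i
  proof -
    have "E (z i) = tensor_op (Q # As i) (z i)"
      unfolding E_def using As(2)[OF i] by (subst tensor_range_comp[OF z1[OF i]]) auto
    then show ?thesis using As(1)[OF i] Q by (simp add: tensor_op_in_range)
  qed
  have Ex: "E (x i) = x i" if i: "i \<in> I" for i
  proof -
    have "E (x i) = tensor_op (Q # As i) (x i)"
      unfolding E_def using As(2)[OF i] x i QQ by (subst tensor_range_comp[of _ "Q # As i"]) auto
    then show ?thesis using x i by (simp add: fixed_points_def)
  qed
  have "(tuple_norm I (\<lambda>i. x i - E (z i)))\<^sup>2 \<le> (tuple_norm I (\<lambda>i. x i - z i))\<^sup>2"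
    unfolding tuple_norm_square
  proof (intro sum_mono power_mono)
    fix i assume "i \<in> I"
    then have "x i - E (z i) = E (x i - z i)" by (simp add: Ex linear_diff[OF linE])
    then show "norm (x i - E (z i)) \<le> norm (x i - z i)" by (simp add: orth_proj_norm_le[OF E])
  qed simp
  also have "\<dots> = (\<Sum>i\<in>I. \<Sum>a\<in>UNIV. (norm (slice n a (x i) - y a i))\<^sup>2)"
    unfolding tuple_norm_square
  proof (intro sum.cong refl)
    fix i assume i: "i \<in> I"
    have "x i - z i \<in> graded (Suc n)"
      using xg[OF i] by (intro subspace_diff subspace_graded) (auto simp: z_def)
    then show "(norm (x i - z i))\<^sup>2 = (\<Sum>a\<in>UNIV. (norm (slice n a (x i) - y a i))\<^sup>2)"
      using i by (simp add: norm_slices linear_diff[OF linear_slice] slz)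
  qed
  also have "\<dots> = (\<Sum>a\<in>UNIV. (tuple_norm I (\<lambda>i. slice n a (x i) - y a i))\<^sup>2)"
    unfolding tuple_norm_square by (rule sum.swap)
  also have "\<dots> \<le> (\<Sum>a\<in>UNIV. (C * norm (slice n a X))\<^sup>2)"
    unfolding X_def using y(3) by (intro sum_mono power_mono) (simp_all add: linear_sum[OF linear_slice])
  also have "\<dots> = (C * norm X)\<^sup>2"
    using xg by (subst power_mult_distrib, subst norm_slices[of X n])
      (auto simp: X_def sum_distrib_left power_mult_distrib intro!: subspace_sum subspace_graded)
  finally have "tuple_norm I (\<lambda>i. x i - E (z i)) \<le> C * norm X"
    by (rule power2_le_imp_le) (simp add: C)
  then show "\<exists>y. (\<forall>i\<in>I. y i \<in> tensor_range (Q # As i)) \<and> (\<Sum>i\<in>I. y i) = 0 \<and>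
      tuple_norm I (\<lambda>i. x i - y i) \<le> C * norm (\<Sum>i\<in>I. x i)"
    unfolding X_def using sum0 Ez by (intro exI[of _ "\<lambda>i. E (z i)"]) auto
qed

lemma tensor_op_Cons_diff:
  "tensor_op ((A - B) # As) f = tensor_op (A # As) f - tensor_op (B # As) f"
proof (rule graded_eqI[of _ "Suc (length As)"])
  fix w :: "'a list" assume "length w = Suc (length As)"
  then obtain a u where "w = a # u" "length u = length As" by (auto simp: length_Suc_conv)
  then show "coeff (tensor_op ((A - B) # As) f) w = coeff (tensor_op (A # As) f - tensor_op (B # As) f) w"
    by (simp add: coeff_tensor_op sum_words_Suc tensor_kernel_Cons algebra_simps sum_subtractf)
qed (auto intro!: subspace_diff subspace_graded)

lemma tensor_op_Cons_zero: "tensor_op (0 # As) f = 0"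
  using tensor_op_Cons_diff[of 0 0 As f] by simp

text \<open>The projection \<open>E\<close>, which is \<open>Q\<close> in the first position, splits
  each \<open>x i\<close> orthogonally into a part with head \<open>Q\<close> and a part with head
  \<open>P i - Q\<close>. Being the same for all \<open>i\<close>, it splits the sum in the same
  way. Both parts are corrected separately and the squared errors add, so \<open>C\<close> does not
  grow.\<close>

lemma stable_sum_head_split:
  fixes As :: "'i \<Rightarrow> (complex ^ 'd ^ 'd) list"
  assumes stR: "stable_sum I (\<lambda>i. tensor_range ((P i - Q) # As i)) C"
    and stQ: "stable_sum I (\<lambda>i. tensor_range (Q # As i)) C" and C: "C \<ge> 0"
    and As: "\<And>i B. i \<in> I \<Longrightarrow> B \<in> set (As i) \<Longrightarrow> proj_matrix B" "\<And>i. i \<in> I \<Longrightarrow> length (As i) = n"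
    and P: "\<And>i. i \<in> I \<Longrightarrow> proj_matrix (P i)" "\<And>i. i \<in> I \<Longrightarrow> proj_matrix (P i - Q)"
    and Q: "proj_matrix Q" "\<And>i. i \<in> I \<Longrightarrow> P i ** Q = Q" "\<And>i. i \<in> I \<Longrightarrow> Q ** P i = Q"
  shows "stable_sum I (\<lambda>i. tensor_range (P i # As i)) C"
  unfolding stable_sum_def
proof (intro allI impI)
  fix x assume x: "\<forall>i\<in>I. x i \<in> tensor_range (P i # As i)"
  define E :: "'d fock \<Rightarrow> 'd fock" where "E = tensor_op (Q # replicate n (mat 1))"
  have E: "orth_proj E" unfolding E_def using Q by (intro orth_proj_tensor_op) auto
  have linE: "linear E" using E by (rule orth_proj_linear)
  have idem: "Q ** Q = Q" "\<And>i. i \<in> I \<Longrightarrow> P i ** P i = P i"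
    using Q P by (auto simp: proj_matrix_def)
  have AsI: "map2 (**) (As i) (As i) = As i" if "i \<in> I" for i
    using As(1)[OF that] by (intro map2_mult_idem) (simp add: proj_matrix_def)
  have E_Cons: "E v = tensor_op ((Q ** A) # As i) v" if "i \<in> I" "v \<in> tensor_range (A # As i)" for i v A
    unfolding E_def using As(2)[OF that(1)] by (subst tensor_range_comp[OF that(2)]) auto
  have P_Cons: "tensor_op (P i # As i) v = tensor_op ((P i ** A) # As i) v"
    if "i \<in> I" "v \<in> tensor_range (A # As i)" for i v A
    using AsI[OF that(1)] by (subst tensor_range_comp[OF that(2)]) auto
  have ExQ: "E (x i) \<in> tensor_range (Q # As i)" if i: "i \<in> I" for i
  proof -
    have "E (x i) = tensor_op (Q # As i) (x i)" using E_Cons[OF i, of "x i" "P i"] x i Q(3)[OF i] by simp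
    then show ?thesis using Q(1) As(1)[OF i] by (simp add: tensor_op_in_range)
  qed
  have ExR: "x i - E (x i) \<in> tensor_range ((P i - Q) # As i)" if i: "i \<in> I" for i
  proof -
    have "x i - E (x i) = tensor_op ((P i - Q) # As i) (x i)"
      using x i E_Cons[OF i, of "x i" "P i"] Q(3)[OF i]
      by (simp add: tensor_op_Cons_diff fixed_points_def)
    then show ?thesis using P(2)[OF i] As(1)[OF i] by (simp add: tensor_op_in_range)
  qed
  have linsub: "subspace (tensor_range Bs :: 'd fock set)" for Bs
    by (intro subspace_fixed_points linear_tensor_op)
  define X where "X = (\<Sum>i\<in>I. x i)"
  obtain y where y: "\<forall>i\<in>I. y i \<in> tensor_range ((P i - Q) # As i)" "(\<Sum>i\<in>I. y i) = 0"
      "tuple_norm I (\<lambda>i. (x i - E (x i)) - y i) \<le> C * norm (\<Sum>i\<in>I. x i - E (x i))"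
    using stR[unfolded stable_sum_def, rule_format, of "\<lambda>i. x i - E (x i)"] ExR by auto
  obtain z where z: "\<forall>i\<in>I. z i \<in> tensor_range (Q # As i)" "(\<Sum>i\<in>I. z i) = 0"
      "tuple_norm I (\<lambda>i. E (x i) - z i) \<le> C * norm (\<Sum>i\<in>I. E (x i))"
    using stQ[unfolded stable_sum_def, rule_format, of "\<lambda>i. E (x i)"] ExQ by auto
  have E0: "E v = 0" if i: "i \<in> I" and v: "v \<in> tensor_range ((P i - Q) # As i)" for i v
    using E_Cons[OF that] Q(3)[OF i] idem by (simp add: matrix_diff_mult tensor_op_Cons_zero)
  have E1: "E v = v" if i: "i \<in> I" and v: "v \<in> tensor_range (Q # As i)" for i v
    using E_Cons[OF that] idem v by (simp add: fixed_points_def)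
  have yz: "y i + z i \<in> tensor_range (P i # As i)" if i: "i \<in> I" for i
  proof (rule subspace_add[OF linsub])
    show "y i \<in> tensor_range (P i # As i)"
      using P_Cons[OF i, of "y i" "P i - Q"] y(1) i idem Q(2)[OF i]
      by (simp add: matrix_diff_mult fixed_points_def)
    show "z i \<in> tensor_range (P i # As i)"
      using P_Cons[OF i, of "z i" Q] z(1) i Q(2)[OF i] by (simp add: fixed_points_def)
  qed
  \<comment> \<open>\<open>E\<close> kills \<open>y i\<close> and fixes \<open>z i\<close>, so the
    two orthogonal parts of the total error are exactly the errors of the two separate
    corrections.\<close>
  have "(tuple_norm I (\<lambda>i. x i - (y i + z i)))\<^sup>2 =
      (tuple_norm I (\<lambda>i. E (x i) - z i))\<^sup>2 + (tuple_norm I (\<lambda>i. (x i - E (x i)) - y i))\<^sup>2"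
    unfolding tuple_norm_square sum.distrib[symmetric]
  proof (intro sum.cong refl)
    fix i assume i: "i \<in> I"
    have "E (x i - (y i + z i)) = E (x i) - z i"
      using E0[OF i, of "y i"] E1[OF i, of "z i"] y(1) z(1) i
      by (simp add: linear_diff[OF linE] linear_add[OF linE])
    moreover have "x i - (y i + z i) - (E (x i) - z i) = x i - E (x i) - y i" by simp
    ultimately show "(norm (x i - (y i + z i)))\<^sup>2 = (norm (E (x i) - z i))\<^sup>2 + (norm ((x i - E (x i)) - y i))\<^sup>2"
      using orth_proj_pythagoras[OF E, of "x i - (y i + z i)"] by (simp only:)
  qed
  also have "\<dots> \<le> (C * norm (E X))\<^sup>2 + (C * norm (X - E X))\<^sup>2"
    using y(3) z(3) unfolding X_def
    by (intro add_mono power_mono) (simp_all add: linear_sum[OF linE] sum_subtractf)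
  also have "\<dots> = (C * norm X)\<^sup>2"
    using orth_proj_pythagoras[OF E, of X] by (simp add: power_mult_distrib distrib_left)
  finally have "tuple_norm I (\<lambda>i. x i - (y i + z i)) \<le> C * norm X"
    by (rule power2_le_imp_le) (simp add: C)
  moreover have "(\<Sum>i\<in>I. y i + z i) = 0" using y(2) z(2) by (simp add: sum.distrib)
  ultimately show "\<exists>y. (\<forall>i\<in>I. y i \<in> tensor_range (P i # As i)) \<and> (\<Sum>i\<in>I. y i) = 0 \<and>
      tuple_norm I (\<lambda>i. x i - y i) \<le> C * norm (\<Sum>i\<in>I. x i)"
    unfolding X_def using yz by (intro exI[of _ "\<lambda>i. y i + z i"] conjI) auto
qed

text \<open>One factor \<open>P i\<close> is traded at a time. Splitting it at the head gives a head
  \<open>Q\<close>, common to all \<open>i\<close>, and a head \<open>P i - Q\<close>, which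
  rotation moves to the end. Both cases have only \<open>n\<close> factors \<open>P i\<close> left,
  the second with one more factor \<open>P i - Q\<close>; hence the induction keeps \<open>m\<close>
  arbitrary.\<close>

lemma stable_sum_add_common:
  fixes P :: "'i \<Rightarrow> complex ^ 'd ^ 'd"
  assumes st: "\<And>m. stable_sum I (\<lambda>i. tensor_range (replicate m (P i - Q))) C" and C: "C \<ge> 0"
    and P: "\<And>i. i \<in> I \<Longrightarrow> proj_matrix (P i)" "\<And>i. i \<in> I \<Longrightarrow> proj_matrix (P i - Q)"
    and Q: "proj_matrix Q" "\<And>i. i \<in> I \<Longrightarrow> P i ** Q = Q" "\<And>i. i \<in> I \<Longrightarrow> Q ** P i = Q"
  shows "stable_sum I (\<lambda>i. tensor_range (replicate n (P i) @ replicate m (P i - Q))) C"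
proof (induction n arbitrary: m)
  case (Suc n)
  let ?As = "\<lambda>i. replicate n (P i) @ replicate m (P i - Q)"
  have proj: "proj_matrix B" if "i \<in> I" "B \<in> set (?As i)" for i B
    using that P by auto
  have "stable_sum I (\<lambda>i. tensor_range (?As i @ [P i - Q])) C"
    using Suc[of "Suc m"] by (simp add: replicate_append_same)
  then have "stable_sum I (\<lambda>i. tensor_range ((P i - Q) # ?As i)) C"
    by (rule stable_sum_rotate[where n = "n + m"]) (simp_all add: C)
  moreover have "stable_sum I (\<lambda>i. tensor_range (Q # ?As i)) C"
    by (rule stable_sum_Cons_common[where n = "n + m", OF Suc C proj _ Q(1)]) auto
  ultimately have "stable_sum I (\<lambda>i. tensor_range (P i # ?As i)) C"
    by (rule stable_sum_head_split[where n = "n + m", OF _ _ C proj _ P Q]) auto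
  then show ?case by simp
qed (simp add: st)

lemma stable_sum_level:
  fixes As :: "'i \<Rightarrow> (complex ^ 'd ^ 'd) list"
  assumes I: "finite I" and len: "\<And>i. i \<in> I \<Longrightarrow> length (As i) = n"
  shows "\<exists>C. stable_sum I (\<lambda>i. tensor_range (As i)) C"
proof -
  obtain B :: "'d fock set" where "finite B" "graded n \<subseteq> span B" using graded_finite_dim by blast
  moreover have "tensor_range (As i) \<subseteq> graded n" if "i \<in> I" for i
    using tensor_range_graded[of _ "As i"] len[OF that] by auto
  ultimately show ?thesis
    by (intro finite_dim_stable_sum[OF I, of _ B]) (auto intro: subspace_fixed_points linear_tensor_op)
qed

text \<open>Splitting off the common part \<open>Q\<close> of all the ranges makes every word that contains all
  letters a strict contraction, so its tensor powers tend to zero.\<close>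

lemma stable_sum_tensor_powers:
  fixes P :: "'i \<Rightarrow> complex ^ 'd ^ 'd"
  assumes "finite I" "\<forall>i\<in>I. proj_matrix (P i)"
  shows "\<exists>C. \<forall>n. stable_sum I (\<lambda>i. tensor_range (replicate n (P i))) C"
  using assms
proof (induction I arbitrary: P rule: finite_psubset_induct)
  case (psubset I)
  show ?case
  proof (cases "I = {}")
    case True
    then show ?thesis by (auto simp: stable_sum_def tuple_norm_def)
  next
    case False
    define W where "W = {v. \<forall>i\<in>I. P i *v v = v}"
    have "vec.subspace W"
      by (auto simp: W_def vec.subspace_def matrix_vector_right_distrib vector_scalar_commute)
    then obtain Q where Q: "proj_matrix Q" "W = {v. Q *v v = v}" using proj_matrix_exists by blast
    have QQ: "Q ** Q = Q" using Q(1) by (simp add: proj_matrix_def)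
    have QW: "Q *v x \<in> W" for x by (simp add: Q(2) matrix_vector_mul_assoc QQ)
    have PQ: "P i ** Q = Q" if "i \<in> I" for i
      using QW that by (simp add: matrix_eq W_def flip: matrix_vector_mul_assoc)
    \<comment> \<open>The adjoint of \<open>PQ\<close>, obtained by moving the symmetric matrices
      across the inner product.\<close>
    have QP: "Q ** P i = Q" if i: "i \<in> I" for i
    proof -
      have "Q *v (P i *v x) = Q *v x" for x
      proof -
        note sym = orth_proj_sym[OF orth_proj_proj_matrix]
        have "(Q *v (P i *v x)) \<bullet> y = (Q *v x) \<bullet> y" for y
        proof -
          have "(Q *v (P i *v x)) \<bullet> y = x \<bullet> ((P i ** Q) *v y)"
            using psubset.prems i Q(1) by (simp add: sym flip: matrix_vector_mul_assoc)
          also have "\<dots> = (Q *v x) \<bullet> y" using Q(1) PQ[OF i] by (simp add: sym)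
          finally show ?thesis .
        qed
        then show ?thesis by (metis vector_eq_rdot)
      qed
      then show ?thesis by (simp add: matrix_eq flip: matrix_vector_mul_assoc)
    qed
    define R where "R i = P i - Q" for i
    have PP: "P i ** P i = P i" if "i \<in> I" for i
      using psubset.prems that by (simp add: proj_matrix_def)
    have R: "proj_matrix (R i)" if i: "i \<in> I" for i
    proof -
      have "R i $ a $ b = cnj (R i $ b $ a)" for a b
      proof -
        have "P i $ a $ b = cnj (P i $ b $ a)" "Q $ a $ b = cnj (Q $ b $ a)"
          using psubset.prems i Q(1) unfolding proj_matrix_def hermitian_def by blast+
        then show ?thesis unfolding R_def by simp
      qed
      then have "hermitian (R i)" unfolding hermitian_def by blast
      then show ?thesis using PQ[OF i] QP[OF i] PP[OF i] QQ
        by (simp add: proj_matrix_def R_def matrix_diff_mult)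
    qed
    \<comment> \<open>A vector fixed by all \<open>R i\<close> is fixed by all \<open>P i\<close>,
      because \<open>P i ** R i = R i\<close>, and so by \<open>Q\<close>. But
      \<open>Q ** R i = 0\<close>, and as \<open>I\<close> is nonempty this kills it.\<close>
    have triv: "x = 0" if x: "\<forall>i\<in>I. R i *v x = x" for x
    proof -
      have "x \<in> W" unfolding W_def
      proof safe
        fix i assume i: "i \<in> I"
        have "P i ** R i = R i" using PQ[OF i] PP[OF i] by (simp add: R_def matrix_diff_mult)
        then show "P i *v x = x" using x i by (metis matrix_vector_mul_assoc)
      qed
      then have "Q *v x = x" using Q(2) by simp
      moreover obtain i where i: "i \<in> I" using False by blast
      moreover have "Q ** R i = 0" using QP[OF i] QQ by (simp add: R_def matrix_diff_mult)
      ultimately show "x = 0" using x by (metis matrix_vector_mul_assoc matrix_vector_mult_0)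
    qed
    interpret projection_sequence I "\<lambda>n i. tensor_op (replicate n (R i))"
      using psubset.hyps R by unfold_locales (auto intro: orth_proj_tensor_op)
    have "\<exists>C N. \<forall>n\<ge>N. stable_sum I (\<lambda>i. tensor_range (replicate n (R i))) C"
    proof (rule eventually_stable_sum[OF False])
      fix w assume w: "set w = I"
      obtain c where c: "0 \<le> c" "c < 1" "\<And>x. norm (word_matrix R w *v x) \<le> c * norm x"
        using word_matrix_contraction[of w R] R triv unfolding w by blast
      have "w \<noteq> []" using w False by auto
      then have "norm (word_prod (\<lambda>i. tensor_op (replicate n (R i))) w v) \<le> c ^ n * norm v" for n v
        using tensor_op_power_norm[OF c(3,1)] by (simp add: word_prod_tensor_op)
      moreover have "(\<lambda>n. c ^ n) \<longlonglongrightarrow> 0" using c by (intro LIMSEQ_power_zero) simp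
      ultimately show "\<exists>e. e \<longlonglongrightarrow> 0 \<and>
          (\<forall>n v. norm (word_prod (\<lambda>i. tensor_op (replicate n (R i))) w v) \<le> e n * norm v)" by blast
    next
      \<comment> \<open>The induction hypothesis covers arbitrary projections on a smaller index
        set. This matters because the \<open>R i\<close> with \<open>i \<noteq> j\<close> may have a
        nonzero common range again.\<close>
      fix j assume "j \<in> I"
      then show "\<exists>C. \<forall>n. stable_sum (I - {j}) (\<lambda>i. tensor_range (replicate n (R i))) C"
        using R by (intro psubset.IH) auto
    qed
    then obtain C0 N where C0: "\<And>n. n \<ge> N \<Longrightarrow> stable_sum I (\<lambda>i. tensor_range (replicate n (R i))) C0"
      by blast
    have "\<exists>C. stable_sum I (\<lambda>i. tensor_range (replicate n (R i))) C" for n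
      using psubset.hyps by (intro stable_sum_level[where n = n]) auto
    then obtain c where c: "\<And>n. stable_sum I (\<lambda>i. tensor_range (replicate n (R i))) (c n)" by metis
    \<comment> \<open>One constant for all levels: \<open>C0\<close> serves from \<open>N\<close>
      on, and the sum dominates the finitely many constants of the levels below.\<close>
    define C where "C = \<bar>C0\<bar> + (\<Sum>n<N. \<bar>c n\<bar>)"
    have C: "C \<ge> 0" by (simp add: C_def sum_nonneg)
    have "stable_sum I (\<lambda>i. tensor_range (replicate n (R i))) C" for n
    proof (cases "n < N")
      case True
      then have "\<bar>c n\<bar> \<le> (\<Sum>n<N. \<bar>c n\<bar>)" by (intro member_le_sum) auto
      then show ?thesis by (intro stable_sum_mono[OF c]) (simp add: C_def)
    next
      case False
      moreover have "0 \<le> (\<Sum>n<N. \<bar>c n\<bar>)" by (rule sum_nonneg) simp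
      then have "C0 \<le> C" unfolding C_def by linarith
      ultimately show ?thesis by (intro stable_sum_mono[OF C0]) simp_all
    qed
    then have "stable_sum I (\<lambda>i. tensor_range (replicate n (P i) @ replicate 0 (P i - Q))) C" for n
      using psubset.prems R Q(1) PQ QP C unfolding R_def
      by (intro stable_sum_add_common) auto
    then show ?thesis by auto
  qed
qed

section \<open>From uniform stability on the levels to the Fock space\<close>

lemma bounded_linear_component: "bounded_linear (component n :: 'd::finite fock \<Rightarrow> 'd fock)"
proof (rule bounded_linear_intro[of _ 1])
  fix f :: "'d fock"
  have "(norm (component n f))\<^sup>2 \<le> (norm f)\<^sup>2"
    using sum_words_le_norm[of f n] norm_graded[of "component n f" n]
    by (simp add: component.rep_eq)
  then have "norm (component n f) \<le> norm f" by (rule power2_le_imp_le) simp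
  then show "norm (component n f) \<le> norm f * 1" by simp
qed (rule fock_eqI; simp add: component.rep_eq)+

lemma component_sum: "component n (\<Sum>i\<in>I. f i) = (\<Sum>i\<in>I. component n (f i))"
  by (rule fock_eqI) (simp add: component.rep_eq coeff_sum)

lemma summable_norm_components:
  fixes f :: "'d::finite fock"
  shows "(\<lambda>n. (norm (component n f))\<^sup>2) summable_on UNIV"
proof -
  have "(\<lambda>w. (cmod (coeff f w))\<^sup>2) summable_on UNIV" by (rule sq_summable_coeff)
  moreover have "bij_betw snd (SIGMA n:UNIV. words n) (UNIV :: 'd list set)"
    by (rule bij_betwI[of _ _ _ "\<lambda>w. (length w, w)"]) auto
  ultimately have "(\<lambda>x. (cmod (coeff f (snd x)))\<^sup>2) summable_on (SIGMA n:UNIV. words n)"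
    by (subst summable_on_reindex_bij_betw[of snd _ UNIV "\<lambda>w. (cmod (coeff f w))\<^sup>2"])
  then have "(\<lambda>n. \<Sum>\<^sub>\<infinity>w\<in>words n. (cmod (coeff f w))\<^sup>2) summable_on UNIV"
    using summable_on_Sigma_banach[of "\<lambda>n w. (cmod (coeff f w))\<^sup>2" UNIV words]
    by (simp add: case_prod_unfold)
  moreover have "(norm (component n f))\<^sup>2 = (\<Sum>w\<in>words n. (cmod (coeff f w))\<^sup>2)" for n
    by (simp add: norm_graded[OF component_graded] component.rep_eq)
  ultimately show ?thesis by simp
qed

text \<open>The coefficient at a word is read off from the level given by its length. The words are
  the disjoint union of the levels, so summability of the squared level norms is summability of all
  squared coefficients.\<close>

lemma assemble_components:
  fixes x :: "nat \<Rightarrow> 'd::finite fock"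
  assumes g: "\<And>n. x n \<in> graded n" and s: "(\<lambda>n. (norm (x n))\<^sup>2) summable_on UNIV"
  shows "\<exists>f. \<forall>n. component n f = x n"
proof -
  define h where "h w = coeff (x (length w)) w" for w
  have "(\<lambda>(n, w). (cmod (coeff (x n) w))\<^sup>2) summable_on (SIGMA n:UNIV. words n)"
  proof (rule summable_on_SigmaI)
    show "((\<lambda>w. case (n, w) of (n, w) \<Rightarrow> (cmod (coeff (x n) w))\<^sup>2) has_sum (norm (x n))\<^sup>2) (words n)" for n
      using has_sum_finite[OF finite_words, of "\<lambda>w. (cmod (coeff (x n) w))\<^sup>2" n] g[of n]
      by (simp add: norm_graded)
  qed (use s in auto)
  moreover have "bij_betw (\<lambda>w. (length w, w)) (UNIV :: 'd list set) (SIGMA n:UNIV. words n)"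
    by (rule bij_betwI[of _ _ _ snd]) auto
  ultimately have "(\<lambda>w. (cmod (h w))\<^sup>2) summable_on UNIV"
    using summable_on_reindex_bij_betw[of "\<lambda>w. (length w, w)" UNIV "SIGMA n:UNIV. words n"
        "\<lambda>(n, w). (cmod (coeff (x n) w))\<^sup>2"]
    by (simp add: h_def)
  then have "coeff (Abs_fock h) = h" by (intro Abs_fock_inverse) simp
  then have "component n (Abs_fock h) = x n" for n
    using g[of n] by (intro graded_eqI[of _ n]) (simp_all add: component.rep_eq h_def)
  then show ?thesis by blast
qed

theorem corollary5p8:
  fixes V :: "nat \<Rightarrow> (complex ^ 'd) set" and r :: nat
  assumes "\<And>i. i \<in> {1..r} \<Longrightarrow> vec.subspace (V i)"
  shows "closed (\<Sum>i=1..r. Fock (V i))"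
proof -
  let ?I = "{1..r}"
  have "\<exists>P. proj_matrix P \<and> V i = {v. P *v v = v}" if "i \<in> ?I" for i
    using assms[OF that] by (rule proj_matrix_exists)
  then obtain P where P: "\<And>i. i \<in> ?I \<Longrightarrow> proj_matrix (P i)" "\<And>i. i \<in> ?I \<Longrightarrow> V i = {v. P i *v v = v}"
    by metis
  let ?H = "\<lambda>n i. tensor_range (replicate n (P i))"
  have H: "tensor_power n (V i) = ?H n i" if "i \<in> ?I" for n i
    using P[OF that] by (intro tensor_power_eq) (auto simp: proj_matrix_def)
  obtain C where C: "\<And>n. stable_sum ?I (?H n) C"
    using stable_sum_tensor_powers[of ?I P] P(1) by auto
  define S where "S n = {(\<Sum>i\<in>?I. x i) |x. \<forall>i\<in>?I. x i \<in> ?H n i}" for n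
  have subH: "subspace (?H n i)" for n i by (intro subspace_fixed_points linear_tensor_op)
  have closedS: "closed (S n)" for n
  proof -
    obtain B :: "'d fock set" where B: "finite B" "graded n \<subseteq> span B" using graded_finite_dim by blast
    have "?H n i \<subseteq> graded n" for i using tensor_range_graded[of _ "replicate n (P i)"] by auto
    then have "S n \<subseteq> graded n" unfolding S_def by (auto intro!: subspace_sum subspace_graded)
    then show ?thesis using B subspace_sum_choice[of ?I "?H n"] subH
      unfolding S_def by (intro closed_finite_dim_subspace[of _ B]) auto
  qed
  \<comment> \<open>Membership in the algebraic sum is thus tested level by level. The inclusion
    from right to left is where the independence of \<open>C\<close> from the level is used.\<close>
  have "(\<Sum>i=1..r. Fock (V i)) = {f. \<forall>n. component n f \<in> S n}"
  proof (intro equalityI subsetI)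
    fix f assume "f \<in> (\<Sum>i=1..r. Fock (V i))"
    then obtain g where g: "f = (\<Sum>i\<in>?I. g i)" "\<forall>i\<in>?I. g i \<in> Fock (V i)"
      by (auto simp: set_sum_alt)
    then show "f \<in> {f. \<forall>n. component n f \<in> S n}"
      using H by (auto simp: S_def Fock_def component_sum intro!: exI[of _ "\<lambda>i. component n (g i)" for n])
  next
    fix f assume "f \<in> {f. \<forall>n. component n f \<in> S n}"
    then have f: "component n f \<in> S n" for n by simp
    \<comment> \<open>An arbitrary decomposition of the component may be far too large. Subtracting
      a nearby relation leaves the sum unchanged and bounds the summands by the component.\<close>
    have "\<exists>u. (\<forall>i\<in>?I. u i \<in> ?H n i) \<and> (\<Sum>i\<in>?I. u i) = component n f \<and>
        tuple_norm ?I u \<le> C * norm (component n f)" for n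
    proof -
      obtain x where x: "\<forall>i\<in>?I. x i \<in> ?H n i" "component n f = (\<Sum>i\<in>?I. x i)"
        using f[of n] unfolding S_def by blast
      obtain y where "\<forall>i\<in>?I. y i \<in> ?H n i" "(\<Sum>i\<in>?I. y i) = 0"
          "tuple_norm ?I (\<lambda>i. x i - y i) \<le> C * norm (\<Sum>i\<in>?I. x i)"
        using C[unfolded stable_sum_def, rule_format, of x n] x(1) by blast
      then show ?thesis using x subH
        by (intro exI[of _ "\<lambda>i. x i - y i"]) (auto simp: sum_subtractf intro: subspace_diff)
    qed
    then obtain u where u: "\<And>n i. i \<in> ?I \<Longrightarrow> u n i \<in> ?H n i" "\<And>n. (\<Sum>i\<in>?I. u n i) = component n f"
        "\<And>n. tuple_norm ?I (u n) \<le> C * norm (component n f)"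
      by metis
    have "\<exists>g. \<forall>n. component n g = u n i" if i: "i \<in> ?I" for i
    proof (rule assemble_components)
      show "u n i \<in> graded n" for n using tensor_range_graded[OF u(1)[OF i]] by simp
      have "(norm (u n i))\<^sup>2 \<le> C\<^sup>2 * (norm (component n f))\<^sup>2" for n
      proof -
        have "norm (u n i) \<le> C * norm (component n f)"
          using norm_le_tuple_norm[of ?I i "u n"] u(3)[of n] i by simp
        then show ?thesis by (metis norm_ge_zero power_mono power_mult_distrib)
      qed
      then show "(\<lambda>n. (norm (u n i))\<^sup>2) summable_on UNIV"
        by (intro summable_on_comparison_test[OF
              summable_on_cmult_right[OF summable_norm_components[of f], of "C\<^sup>2"]]) auto
    qed
    then obtain g where g: "\<And>i n. i \<in> ?I \<Longrightarrow> component n (g i) = u n i" by metis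
    have "f = (\<Sum>i\<in>?I. g i)"
    proof (rule fock_eqI)
      fix w :: "'d list"
      have "component (length w) f = component (length w) (\<Sum>i\<in>?I. g i)"
        unfolding component_sum using g u(2) by simp
      from arg_cong[OF this, of "\<lambda>h. coeff h w"] show "coeff f w = coeff (\<Sum>i\<in>?I. g i) w"
        by (simp add: component.rep_eq)
    qed
    moreover have "\<forall>i\<in>?I. g i \<in> Fock (V i)" using g u(1) H by (simp add: Fock_def)
    ultimately show "f \<in> (\<Sum>i=1..r. Fock (V i))" by (auto simp: set_sum_alt)
  qed
  \<comment> \<open>Each \<open>S n\<close> is finite-dimensional and hence closed, and
    \<open>component n\<close> is continuous, so this is an intersection of closed sets.\<close>
  also have "\<dots> = (\<Inter>n. component n -` S n)" by auto
  also have "closed \<dots>"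
    using closedS by (intro closed_INT ballI continuous_closed_vimage)
      (auto intro: linear_continuous_at bounded_linear_component)
  finally show ?thesis .
qed

end
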